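(* There is an algorithm that, given a graph $G$ on $n$ vertices with minimum vertex degree $\delta$, decides in time $O(\delta\cdot n^4)$ whether there exists a graph $H$ with girth at least six such that $G=H^2$.
   Context: All graphs are finite, undirected and simple. For a graph $H$, $H^2$ is the graph on the same vertex set in which two distinct vertices are adjacent iff their distance in $H$ is at most $2$. The girth of a graph is the length of a shortest cycle ($\infty$ if acyclic).
   Formalization: For nonempty graphs with an isolated vertex (δ = 0) the literal bound O(δ·n^4) would be zero time, which no algorithm meets, so δ is replaced by max(1, δ) there; the empty graph, which has no minimum degree, is excluded. *)

theory Defs
  imports Main "HOL-Library.Extended_Nat"
begin

section \<open>Graphs\<close>

type_synonym 'a graph = "'a set \<times> 'a set set"

abbreviation verts :: "'a graph \<Rightarrow> 'a set" where "verts \<equiv> fst"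
abbreviation edges :: "'a graph \<Rightarrow> 'a set set" where "edges \<equiv> snd"

definition simple_graph :: "'a graph \<Rightarrow> bool" where
  "simple_graph G \<longleftrightarrow> finite (verts G) \<and> (\<forall>e \<in> edges G. e \<subseteq> verts G \<and> card e = 2)"

definition degree :: "'a graph \<Rightarrow> 'a \<Rightarrow> nat" where
  "degree G v = card {u \<in> verts G. {v, u} \<in> edges G}"

definition min_degree :: "'a graph \<Rightarrow> nat" where
  "min_degree G = Min (degree G ` verts G)"

definition walk :: "'a graph \<Rightarrow> 'a list \<Rightarrow> bool" where
  "walk G p \<longleftrightarrow> p \<noteq> [] \<and> set p \<subseteq> verts G \<and>
     (\<forall>i. Suc i < length p \<longrightarrow> {p ! i, p ! Suc i} \<in> edges G)"

text \<open>The distance of vertices in different components is \<open>\<infinity>\<close>, the infimum of the empty set.\<close>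

definition distance :: "'a graph \<Rightarrow> 'a \<Rightarrow> 'a \<Rightarrow> enat" where
  "distance G u v = Inf {enat (length p - 1) | p. walk G p \<and> hd p = u \<and> last p = v}"

definition square :: "'a graph \<Rightarrow> 'a graph" where
  "square H = (verts H,
     {{u, v} | u v. u \<in> verts H \<and> v \<in> verts H \<and> u \<noteq> v \<and> distance H u v \<le> 2})"

text \<open>A cycle is listed without repeating its first vertex, so its length is the length of the list.\<close>

definition cycle :: "'a graph \<Rightarrow> 'a list \<Rightarrow> bool" where
  "cycle G p \<longleftrightarrow> 3 \<le> length p \<and> distinct p \<and> walk G p \<and> {last p, hd p} \<in> edges G"

definition girth :: "'a graph \<Rightarrow> enat" where
  "girth G = Inf {enat (length p) | p. cycle G p}"

section \<open>Model of computation\<close>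

text \<open>
  A word RAM with structured control flow. Memory is divided into named arrays
  (a program mentions finitely many, so they can be interleaved in one linear memory);
  a scalar variable is the cell at index 0 of an array.
  Subtraction is truncated at 0, and comparisons yield 0 or 1.
\<close>

datatype expr =
    Const nat
  | Elem string expr
  | Plus expr expr
  | Minus expr expr
  | Times expr expr
  | Less expr expr
  | Equal expr expr

type_synonym memory = "string \<Rightarrow> nat \<Rightarrow> nat"

primrec val :: "expr \<Rightarrow> memory \<Rightarrow> nat" where
  "val (Const k) s = k"
| "val (Elem x e) s = s x (val e s)"
| "val (Plus e f) s = val e s + val f s"
| "val (Minus e f) s = val e s - val f s"
| "val (Times e f) s = val e s * val f s"
| "val (Less e f) s = (if val e s < val f s then 1 else 0)"
| "val (Equal e f) s = (if val e s = val f s then 1 else 0)"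

text \<open>
  All values occurring in the evaluation, including addresses and intermediate results,
  have to be less than the word limit \<open>W\<close>.
\<close>

primrec fits :: "nat \<Rightarrow> expr \<Rightarrow> memory \<Rightarrow> bool" where
  "fits W (Const k) s \<longleftrightarrow> k < W"
| "fits W (Elem x e) s \<longleftrightarrow> fits W e s \<and> s x (val e s) < W"
| "fits W (Plus e f) s \<longleftrightarrow> fits W e s \<and> fits W f s \<and> val e s + val f s < W"
| "fits W (Minus e f) s \<longleftrightarrow> fits W e s \<and> fits W f s"
| "fits W (Times e f) s \<longleftrightarrow> fits W e s \<and> fits W f s \<and> val e s * val f s < W"
| "fits W (Less e f) s \<longleftrightarrow> fits W e s \<and> fits W f s \<and> 1 < W"
| "fits W (Equal e f) s \<longleftrightarrow> fits W e s \<and> fits W f s \<and> 1 < W"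

text \<open>Every constant, memory access, arithmetic operation and comparison takes one time unit.\<close>

primrec cost :: "expr \<Rightarrow> nat" where
  "cost (Const k) = 1"
| "cost (Elem x e) = cost e + 1"
| "cost (Plus e f) = cost e + cost f + 1"
| "cost (Minus e f) = cost e + cost f + 1"
| "cost (Times e f) = cost e + cost f + 1"
| "cost (Less e f) = cost e + cost f + 1"
| "cost (Equal e f) = cost e + cost f + 1"

datatype prog =
    Skip
  | Assign string expr expr
  | Seq prog prog
  | Cond expr prog prog
  | While expr prog

text \<open>
  \<open>exec W c s t s'\<close>: started in memory \<open>s\<close>, program \<open>c\<close> halts after \<open>t\<close> time units in
  memory \<open>s'\<close>, and all values occurring on the way are less than \<open>W\<close>.
  \<open>Assign x i e\<close> stores \<open>e\<close> in cell \<open>i\<close> of array \<open>x\<close>.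
\<close>

inductive exec :: "nat \<Rightarrow> prog \<Rightarrow> memory \<Rightarrow> nat \<Rightarrow> memory \<Rightarrow> bool" for W where
  Skip: "exec W Skip s 1 s"
| Assign: "fits W i s \<Longrightarrow> fits W e s \<Longrightarrow>
    exec W (Assign x i e) s (cost i + cost e + 1) (s(x := (s x)(val i s := val e s)))"
| Seq: "exec W c s t s' \<Longrightarrow> exec W d s' u s'' \<Longrightarrow> exec W (Seq c d) s (t + u) s''"
| CondTrue: "fits W b s \<Longrightarrow> val b s \<noteq> 0 \<Longrightarrow> exec W c s t s' \<Longrightarrow>
    exec W (Cond b c d) s (cost b + 1 + t) s'"
| CondFalse: "fits W b s \<Longrightarrow> val b s = 0 \<Longrightarrow> exec W d s t s' \<Longrightarrow>
    exec W (Cond b c d) s (cost b + 1 + t) s'"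
| WhileFalse: "fits W b s \<Longrightarrow> val b s = 0 \<Longrightarrow> exec W (While b c) s (cost b + 1) s"
| WhileTrue: "fits W b s \<Longrightarrow> val b s \<noteq> 0 \<Longrightarrow> exec W c s t s' \<Longrightarrow>
    exec W (While b c) s' u s'' \<Longrightarrow> exec W (While b c) s (cost b + 1 + t + u) s''"

inductive_cases exec_SkipE: "exec W Skip s t s'"
inductive_cases exec_AssignE: "exec W (Assign x i e) s t s'"
inductive_cases exec_SeqE: "exec W (Seq c d) s t s'"
inductive_cases exec_CondE: "exec W (Cond b c d) s t s'"
inductive_cases exec_WhileE: "exec W (While b c) s t s'"

text \<open>The word limit does not influence the outcome, which is unique.\<close>

lemma exec_deterministic:
  "exec W c s t s' \<Longrightarrow> exec W' c s r z \<Longrightarrow> t = r \<and> s' = z"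
proof (induction arbitrary: r z rule: exec.induct)
  case (Seq c s t s' d u s'')
  from Seq.prems obtain t1 s1 u1 where
    *: "r = t1 + u1" "exec W' c s t1 s1" "exec W' d s1 u1 z"
    by (rule exec_SeqE)
  from Seq.IH(1)[OF *(2)] have "t = t1" "s' = s1" by auto
  with Seq.IH(2) *(1,3) show ?case by blast
next
  case (WhileTrue b s c t s' u s'')
  from WhileTrue.prems show ?case
  proof (rule exec_WhileE)
    assume "val b s = 0"
    with WhileTrue.hyps(2) show ?thesis by simp
  next
    fix t1 s1 u1
    assume *: "r = Suc (cost b + t1 + u1)" "exec W' c s t1 s1" "exec W' (While b c) s1 u1 z"
    from WhileTrue.IH(1)[OF *(2)] have "t = t1" "s' = s1" by auto
    with WhileTrue.IH(2) *(1,3) show ?thesis by simp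
  qed
next
  case (CondTrue b s c t s' d)
  from CondTrue.prems CondTrue.hyps(2) CondTrue.IH show ?case
    by (auto elim!: exec_CondE)
next
  case (CondFalse b s d t s' c)
  from CondFalse.prems CondFalse.hyps(2) CondFalse.IH show ?case
    by (auto elim!: exec_CondE)
next
  case (WhileFalse b s c)
  from WhileFalse.prems show ?case
    by (rule exec_WhileE) (use WhileFalse.hyps in simp_all)
qed (auto elim: exec_SkipE exec_AssignE)

text \<open>
  A graph with vertex set \<open>{0..<n}\<close> is given by \<open>n\<close> and its adjacency matrix, stored row by row;
  all other cells are 0.
\<close>

definition input :: "nat graph \<Rightarrow> memory" where
  "input G = (\<lambda>x i.
     if x = ''n'' \<and> i = 0 then card (verts G)
     else if x = ''adj'' \<and>
       (\<exists>u \<in> verts G. \<exists>v \<in> verts G. i = u * card (verts G) + v \<and> {u, v} \<in> edges G) then 1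
     else 0)"

definition accepting :: "memory \<Rightarrow> bool" where
  "accepting s \<longleftrightarrow> s ''out'' 0 = 1"

text \<open>
  Program \<open>c\<close> decides the graph property \<open>P\<close> within time \<open>T\<close> on words of \<open>O(log n)\<close> bits:
  the number of different words is bounded by a fixed power of \<open>n + 2\<close>.
  Graphs are nonempty, as the minimum degree of the empty graph is undefined.
\<close>

definition decides_in_time ::
  "prog \<Rightarrow> (nat graph \<Rightarrow> bool) \<Rightarrow> (nat graph \<Rightarrow> nat) \<Rightarrow> bool" where
  "decides_in_time c P T \<longleftrightarrow>
     (\<exists>k. \<forall>G n. simple_graph G \<and> verts G = {0..<n} \<and> 0 < n \<longrightarrow>
        (\<exists>t s. exec ((n + 2) ^ k) c (input G) t s \<and> t \<le> T G \<and> (accepting s \<longleftrightarrow> P G)))"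

end

theory Submission
  imports Defs
begin

text \<open>
  Let \<open>xy\<close> be an edge of a root \<open>H\<close> of girth at least six. The common neighbours of \<open>x\<close> and \<open>y\<close>
  in \<open>G = H\<^sup>2\<close> split into two cliques without edges in between, the other \<open>H\<close>-neighbours of \<open>x\<close> and
  those of \<open>y\<close>. So there are only two candidates for the \<open>H\<close>-neighbourhood of \<open>x\<close>. Moreover the
  \<open>H\<close>-neighbourhood of one end of an edge determines that of the other end, so the choice of \<open>xy\<close>
  and of the candidate determines \<open>H\<close> on the component of \<open>x\<close>. Constructing the candidate root and
  checking it takes time \<open>O(n\<^sup>3)\<close>.

  For every vertex \<open>y\<close> the program tries only the edge to its largest neighbour \<open>x\<close> in \<open>G\<close>, that
  is, \<open>2n\<close> candidates in total. This suffices: if \<open>x\<close> is the largest vertex of a component of \<open>G\<close>, it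
  is the largest neighbour of each of its neighbours, among them its neighbours in \<open>H\<close>.
  The running time is therefore \<open>O(n\<^sup>4)\<close>, even without the factor \<open>\<delta>\<close>.
\<close>

section \<open>Loop programs\<close>

text \<open>The only loops count from 0 up to the content of \<open>''n''\<close>. Termination, word
  size and the exponent of the running time can then be read off the syntax.\<close>

datatype loop_prog =
    LSkip
  | LAssign string expr expr
  | LSeq loop_prog loop_prog (infixr ";;" 60)
  | LCond expr loop_prog loop_prog
  | LFor string loop_prog

abbreviation Var :: "string \<Rightarrow> expr" where
  "Var x \<equiv> Elem x (Const 0)"

primrec compile :: "loop_prog \<Rightarrow> prog" where
  "compile LSkip = Skip"
| "compile (LAssign x i e) = Assign x i e"
| "compile (c ;; d) = Seq (compile c) (compile d)"
| "compile (LCond b c d) = Cond b (compile c) (compile d)"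
| "compile (LFor i c) = Seq (Assign i (Const 0) (Const 0))
     (While (Less (Var i) (Var ''n''))
       (Seq (compile c) (Assign i (Const 0) (Plus (Var i) (Const 1)))))"

section \<open>Semantics of loop programs and an invariant rule\<close>

definition upd :: "memory \<Rightarrow> string \<Rightarrow> nat \<Rightarrow> nat \<Rightarrow> memory" where
  "upd s x i v = s(x := (s x)(i := v))"

lemma upd_apply: "upd s x i v z = (if z = x then (s x)(i := v) else s z)"
  by (simp add: upd_def)

lemma upd_same: "upd s x i v x i = v"
  by (simp add: upd_def)

text \<open>For well-formed loops this is the memory at the moment when the compiled loop evaluates
  its test after \<open>k\<close> rounds, so the counter already holds \<open>k\<close>.\<close>

primrec iterate :: "string \<Rightarrow> (memory \<Rightarrow> memory) \<Rightarrow> memory \<Rightarrow> nat \<Rightarrow> memory" where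
  "iterate i f s 0 = upd s i 0 0"
| "iterate i f s (Suc k) = upd (f (iterate i f s k)) i 0 (Suc k)"

primrec sem :: "nat \<Rightarrow> loop_prog \<Rightarrow> memory \<Rightarrow> memory" where
  "sem N LSkip s = s"
| "sem N (LAssign x i e) s = upd s x (val i s) (val e s)"
| "sem N (c ;; d) s = sem N d (sem N c s)"
| "sem N (LCond b c d) s = (if val b s \<noteq> 0 then sem N c s else sem N d s)"
| "sem N (LFor i c) s = iterate i (sem N c) s N"

primrec writes :: "loop_prog \<Rightarrow> string set" where
  "writes LSkip = {}"
| "writes (LAssign x i e) = {x}"
| "writes (c ;; d) = writes c \<union> writes d"
| "writes (LCond b c d) = writes c \<union> writes d"
| "writes (LFor i c) = insert i (writes c)"

lemma iterate_frame:
  assumes "\<And>s. f s z = s z" "z \<noteq> i"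
  shows "iterate i f s k z = s z"
  by (induction k) (use assms in \<open>simp_all add: upd_apply\<close>)

lemma sem_frame: "z \<notin> writes c \<Longrightarrow> sem N c s z = s z"
  by (induction c arbitrary: s) (auto simp: upd_apply iterate_frame)

lemma iterate_counter: "iterate i f s k i 0 = k"
  by (cases k) (simp_all add: upd_same)

text \<open>The premise \<open>counter\<close> asks that the invariant ignore the loop counter,
  which is overwritten between rounds. In return, a round may assume that the counter equals
  \<open>k\<close> and that arrays outside \<open>writes c\<close> still have their initial
  contents.\<close>

lemma sem_For_induct:
  assumes base: "P 0 s"
    and step: "\<And>k s'. k < N \<Longrightarrow> P k s' \<Longrightarrow> s' i 0 = k \<Longrightarrow>
      (\<And>z. z \<noteq> i \<Longrightarrow> z \<notin> writes c \<Longrightarrow> s' z = s z) \<Longrightarrow> P (Suc k) (sem N c s')"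
    and counter: "\<And>k s' v. P k s' \<Longrightarrow> P k (upd s' i 0 v)"
  shows "P N (sem N (LFor i c) s)"
proof -
  have "P k (iterate i (sem N c) s k)" if "k \<le> N" for k
    using that
  proof (induction k)
    case 0
    show ?case by (simp add: base counter)
  next
    case (Suc k)
    have "P (Suc k) (sem N c (iterate i (sem N c) s k))"
    proof (rule step)
      fix z assume "z \<noteq> i" "z \<notin> writes c"
      then show "iterate i (sem N c) s k z = s z"
        by (simp add: iterate_frame sem_frame)
    qed (use Suc in \<open>simp_all add: iterate_counter\<close>)
    then show ?case by (simp add: counter)
  qed
  then show ?thesis by simp
qed

text \<open>Right-hand sides whose value never exceeds the largest of 1 and the contents of the memory.\<close>

fun small :: "expr \<Rightarrow> bool" where
  "small (Const k) \<longleftrightarrow> k \<le> 1"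
| "small (Elem x e) \<longleftrightarrow> True"
| "small (Less e f) \<longleftrightarrow> True"
| "small (Equal e f) \<longleftrightarrow> True"
| "small _ \<longleftrightarrow> False"

section \<open>Word size and running time of compiled programs\<close>

primrec bits :: "expr \<Rightarrow> bool" where
  "bits (Const k) \<longleftrightarrow> k \<le> 1"
| "bits (Elem x e) \<longleftrightarrow> bits e"
| "bits (Plus e f) \<longleftrightarrow> bits e \<and> bits f"
| "bits (Minus e f) \<longleftrightarrow> bits e \<and> bits f"
| "bits (Times e f) \<longleftrightarrow> bits e \<and> bits f"
| "bits (Less e f) \<longleftrightarrow> bits e \<and> bits f"
| "bits (Equal e f) \<longleftrightarrow> bits e \<and> bits f"

text \<open>Protecting \<open>''n''\<close> fixes the bound of all loops, and protecting the counter
  from the body makes every loop run exactly \<open>N\<close> rounds.\<close>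

primrec wf_prog :: "loop_prog \<Rightarrow> bool" where
  "wf_prog LSkip \<longleftrightarrow> True"
| "wf_prog (LAssign x i e) \<longleftrightarrow> x \<noteq> ''n'' \<and> bits i \<and> bits e \<and> small e"
| "wf_prog (c ;; d) \<longleftrightarrow> wf_prog c \<and> wf_prog d"
| "wf_prog (LCond b c d) \<longleftrightarrow> bits b \<and> wf_prog c \<and> wf_prog d"
| "wf_prog (LFor i c) \<longleftrightarrow> i \<noteq> ''n'' \<and> i \<notin> writes c \<and> wf_prog c"

text \<open>The 5 is the cost of the loop test, the most expensive of the expressions that
  \<open>compile\<close> adds.\<close>

primrec width :: "loop_prog \<Rightarrow> nat" where
  "width LSkip = 0"
| "width (LAssign x i e) = max (cost i) (cost e)"
| "width (c ;; d) = max (width c) (width d)"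
| "width (LCond b c d) = max (cost b) (max (width c) (width d))"
| "width (LFor i c) = max 5 (width c)"

primrec nesting :: "loop_prog \<Rightarrow> nat" where
  "nesting LSkip = 0"
| "nesting (LAssign x i e) = 0"
| "nesting (c ;; d) = max (nesting c) (nesting d)"
| "nesting (LCond b c d) = max (nesting c) (nesting d)"
| "nesting (LFor i c) = Suc (nesting c)"

text \<open>The 21 pays for the loop overhead: test and increment take 12 time units per round,
  initialisation and the last test take 9, and there is at least one round when
  \<open>0 < N\<close>.\<close>

primrec const_factor :: "loop_prog \<Rightarrow> nat" where
  "const_factor LSkip = 1"
| "const_factor (LAssign x i e) = cost i + cost e + 1"
| "const_factor (c ;; d) = const_factor c + const_factor d"
| "const_factor (LCond b c d) = cost b + 1 + const_factor c + const_factor d"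
| "const_factor (LFor i c) = const_factor c + 21"

definition bounded :: "nat \<Rightarrow> memory \<Rightarrow> bool" where
  "bounded N s \<longleftrightarrow> s ''n'' 0 = N \<and> (\<forall>x i. s x i \<le> N)"

lemma bounded_upd: "bounded N s \<Longrightarrow> x \<noteq> ''n'' \<Longrightarrow> v \<le> N \<Longrightarrow> bounded N (upd s x i v)"
  by (auto simp: bounded_def upd_apply)

lemma val_small: "small e \<Longrightarrow> bounded N s \<Longrightarrow> 0 < N \<Longrightarrow> val e s \<le> N"
  by (cases e rule: small.cases) (auto simp: bounded_def)

lemma power_add_le:
  fixes a :: nat
  assumes "2 \<le> a"
  shows "a ^ i + a ^ j \<le> a ^ Suc (i + j)"
proof -
  have "1 \<le> a ^ i" "1 \<le> a ^ j" using assms by auto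
  then have "a ^ i \<le> a ^ (i + j)" "a ^ j \<le> a ^ (i + j)"
    by (simp_all add: power_add)
  then have "a ^ i + a ^ j \<le> 2 * a ^ (i + j)" by simp
  also have "\<dots> \<le> a * a ^ (i + j)" using assms by simp
  finally show ?thesis by simp
qed

text \<open>Costs of operands add up in the exponent. The unit of cost of the operation itself
  supplies one more factor \<open>N + 2\<close>, which absorbs the factor 2 of a sum.\<close>

lemma val_le_power:
  assumes "bits e" "bounded N s"
  shows "val e s \<le> (N + 2) ^ cost e"
  using assms
proof (induction e)
  case (Elem x e)
  then have "s x (val e s) \<le> N" by (simp add: bounded_def)
  also have "N \<le> (N + 2) ^ Suc (cost e)"
  proof -
    have "1 \<le> (N + 2) ^ cost e" by simp
    then have "(N + 2) * 1 \<le> (N + 2) * (N + 2) ^ cost e" by (rule mult_le_mono2)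
    then show ?thesis by simp
  qed
  finally show ?case by simp
next
  case (Plus e f)
  then have "val e s + val f s \<le> (N + 2) ^ cost e + (N + 2) ^ cost f" by (intro add_mono) auto
  also have "\<dots> \<le> (N + 2) ^ Suc (cost e + cost f)" by (rule power_add_le) simp
  finally show ?case by simp
next
  case (Minus e f)
  then have "val e s - val f s \<le> (N + 2) ^ cost e" using diff_le_self le_trans by fastforce
  also have "\<dots> \<le> (N + 2) ^ (cost e + cost f + 1)" by (rule power_increasing) auto
  finally show ?case by simp
next
  case (Times e f)
  then have "val e s * val f s \<le> (N + 2) ^ cost e * (N + 2) ^ cost f" by (intro mult_mono) auto
  also have "\<dots> \<le> (N + 2) ^ (cost e + cost f + 1)"
    by (subst power_add[symmetric], rule power_increasing) auto
  finally show ?case by simp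
qed (simp_all add: le_trans[OF _ one_le_power] del: power_Suc)

text \<open>No subexpression costs more than \<open>e\<close>, so the strict inequality between cost
  and \<open>k\<close> covers all intermediate values at once.\<close>

lemma fits_if_bounded:
  assumes "bits e" "bounded N s" "cost e < k"
  shows "fits ((N + 2) ^ k) e s"
proof -
  have less: "val e' s < (N + 2) ^ k" if "bits e'" "cost e' < k" for e'
  proof -
    have "val e' s \<le> (N + 2) ^ cost e'" using val_le_power that assms(2) by blast
    also have "\<dots> < (N + 2) ^ k" using that by (intro power_strict_increasing) auto
    finally show ?thesis .
  qed
  show ?thesis
    using assms(1,3)
  proof (induction e)
    case (Const c)
    then show ?case using less[of "Const c"] by simp
  next
    case (Elem x e)
    then show ?case using less[of "Elem x e"] by simp
  next
    case (Plus e f)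
    then show ?case using less[of "Plus e f"] by simp
  next
    case (Times e f)
    then show ?case using less[of "Times e f"] by simp
  qed (use one_less_power[of "N + 2" k] in auto)
qed

text \<open>Every loop multiplies the time by \<open>N\<close>, hence the exponent
  \<open>nesting\<close>. Assigned values are small, so \<open>bounded\<close> is preserved and one
  word limit serves the whole run.\<close>

lemma exec_compile:
  assumes "wf_prog c" "bounded N s" "0 < N" "width c < k"
  shows "bounded N (sem N c s) \<and>
    (\<exists>t \<le> const_factor c * N ^ nesting c. exec ((N + 2) ^ k) (compile c) s t (sem N c s))"
  using assms
proof (induction c arbitrary: s)
  case LSkip
  then show ?case using exec.Skip by auto
next
  case (LAssign x i e)
  then have "exec ((N + 2) ^ k) (Assign x i e) s (cost i + cost e + 1) (sem N (LAssign x i e) s)"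
    unfolding sem.simps upd_def by (intro exec.Assign fits_if_bounded) auto
  with LAssign show ?case by (auto simp: bounded_upd val_small)
next
  case (LSeq c d)
  let ?M = "max (nesting c) (nesting d)"
  from LSeq obtain t where t: "t \<le> const_factor c * N ^ nesting c"
    "exec ((N + 2) ^ k) (compile c) s t (sem N c s)" and b: "bounded N (sem N c s)" by auto
  from LSeq b obtain u where u: "u \<le> const_factor d * N ^ nesting d"
    "exec ((N + 2) ^ k) (compile d) (sem N c s) u (sem N d (sem N c s))"
    and "bounded N (sem N d (sem N c s))" by force
  moreover have "N ^ nesting c \<le> N ^ ?M" "N ^ nesting d \<le> N ^ ?M"
    using \<open>0 < N\<close> by (auto intro!: power_increasing)
  then have "t + u \<le> (const_factor c + const_factor d) * N ^ ?M"
    using t(1) u(1) unfolding add_mult_distrib by (meson add_mono le_trans mult_le_mono2)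
  ultimately show ?case
    using exec.Seq[OF t(2) u(2)] by auto
next
  case (LCond b c d)
  let ?M = "max (nesting c) (nesting d)" and ?K = "cost b + 1 + const_factor c + const_factor d"
  have fits: "fits ((N + 2) ^ k) b s" using LCond.prems by (intro fits_if_bounded) auto
  have pos: "1 \<le> N ^ ?M" using \<open>0 < N\<close> by simp
  \<comment> \<open>One estimate for both branches: \<open>e\<close> stands for the branch that is
    executed.\<close>
  have le: "cost b + 1 + t \<le> ?K * N ^ ?M"
    if "t \<le> const_factor e * N ^ nesting e" "e = c \<or> e = d" for t e
  proof -
    have "N ^ nesting e \<le> N ^ ?M" using that(2) \<open>0 < N\<close> by (auto intro!: power_increasing)
    then have "t \<le> const_factor e * N ^ ?M" using that(1) by (meson le_trans mult_le_mono2)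
    moreover have "cost b + 1 \<le> (cost b + 1) * N ^ ?M"
      using mult_le_mono2[OF pos, of "cost b + 1"] by simp
    ultimately have "cost b + 1 + t \<le> (cost b + 1 + const_factor e) * N ^ ?M"
      by (simp only: add_mult_distrib add_mono)
    also have "\<dots> \<le> ?K * N ^ ?M" using that(2) by (intro mult_le_mono1) auto
    finally show ?thesis .
  qed
  show ?case
  proof (cases "val b s = 0")
    case True
    from LCond obtain t where t: "t \<le> const_factor d * N ^ nesting d"
      "exec ((N + 2) ^ k) (compile d) s t (sem N d s)" "bounded N (sem N d s)" by auto
    show ?thesis using exec.CondFalse[OF fits True t(2)] le[OF t(1)] t(3) True by auto
  next
    case False
    from LCond obtain t where t: "t \<le> const_factor c * N ^ nesting c"
      "exec ((N + 2) ^ k) (compile c) s t (sem N c s)" "bounded N (sem N c s)" by auto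
    show ?thesis using exec.CondTrue[OF fits False t(2)] le[OF t(1)] t(3) False by auto
  qed
next
  case (LFor i c)
  let ?W = "(N + 2) ^ k" and ?T = "const_factor c * N ^ nesting c"
  let ?s = "iterate i (sem N c) s"
  let ?b = "Less (Var i) (Var ''n'')" and ?a = "Assign i (Const 0) (Plus (Var i) (Const 1))"
  have i: "i \<noteq> ''n''" "i \<notin> writes c" and k: "5 < k" using LFor.prems by auto
  have bd: "bounded N (?s j)" if "j \<le> N" for j
    using that by (induction j) (use LFor i in \<open>auto intro!: bounded_upd\<close>)
  have n: "?s j ''n'' 0 = N" if "j \<le> N" for j using bd[OF that] by (simp add: bounded_def)
  \<comment> \<open>The induction runs downwards from the state after all rounds, where only the
    failing test remains, at cost 6. Each earlier round adds \<open>?T + 12\<close>.\<close>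
  have loop: "\<exists>t \<le> (N - j) * (?T + 12) + 6. exec ?W (While ?b (Seq (compile c) ?a)) (?s j) t (?s N)"
    if "j \<le> N" for j
    using that
  proof (induction rule: inc_induct)
    case base
    have "exec ?W (While ?b (Seq (compile c) ?a)) (?s N) (cost ?b + 1) (?s N)"
      using bd n k by (intro exec.WhileFalse fits_if_bounded) (auto simp: iterate_counter)
    then show ?case by (intro exI[of _ "cost ?b + 1"]) simp
  next
    case (step j)
    then have j: "j \<le> N" by simp
    from LFor bd[OF j] obtain t where t: "t \<le> ?T" "exec ?W (compile c) (?s j) t (sem N c (?s j))"
      and b: "bounded N (sem N c (?s j))" by auto
    have ci: "sem N c (?s j) i 0 = j" using i by (simp add: sem_frame iterate_counter)
    have "exec ?W ?a (sem N c (?s j)) 6 (?s (Suc j))"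
    proof -
      have "fits ?W (Const 0) (sem N c (?s j))" "fits ?W (Plus (Var i) (Const 1)) (sem N c (?s j))"
        using fits_if_bounded[OF _ b] k by (simp_all del: fits.simps)
      from exec.Assign[OF this, of i] show ?thesis using ci by (simp add: upd_def eval_nat_numeral)
    qed
    then have body: "exec ?W (Seq (compile c) ?a) (?s j) (t + 6) (?s (Suc j))"
      by (rule exec.Seq[OF t(2)])
    from step obtain u where u: "u \<le> (N - Suc j) * (?T + 12) + 6"
      "exec ?W (While ?b (Seq (compile c) ?a)) (?s (Suc j)) u (?s N)" by auto
    have "exec ?W (While ?b (Seq (compile c) ?a)) (?s j) (cost ?b + 1 + (t + 6) + u) (?s N)"
    proof (rule exec.WhileTrue[OF _ _ body u(2)])
      show "fits ?W ?b (?s j)" using bd[OF j] k by (intro fits_if_bounded) auto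
      show "val ?b (?s j) \<noteq> 0" using n[OF j] step(2) by (simp add: iterate_counter)
    qed
    moreover have "N - j = Suc (N - Suc j)" using step(2) by simp
    then have "cost ?b + 1 + (t + 6) + u \<le> (N - j) * (?T + 12) + 6" using t(1) u(1) by simp
    ultimately show ?case by blast
  qed
  have init: "exec ?W (Assign i (Const 0) (Const 0)) s 3 (?s 0)"
  proof -
    have "fits ?W (Const 0) s" using fits_if_bounded LFor.prems(2) k by (simp del: fits.simps)
    from exec.Assign[OF this this, of i] show ?thesis by (simp add: upd_def eval_nat_numeral)
  qed
  from loop[of 0] obtain t where t: "t \<le> N * (?T + 12) + 6"
    "exec ?W (While ?b (Seq (compile c) ?a)) (?s 0) t (?s N)" by auto
  have "exec ?W (compile (LFor i c)) s (3 + t) (sem N (LFor i c) s)"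
    unfolding compile.simps sem.simps using exec.Seq[OF init t(2)] .
  moreover have "3 + t \<le> const_factor (LFor i c) * N ^ nesting (LFor i c)"
  proof -
    have "1 \<le> N ^ nesting c" "1 \<le> N * N ^ nesting c" using \<open>0 < N\<close> by (auto simp: Suc_leI)
    moreover from this(1) have "N \<le> N * N ^ nesting c" using mult_le_mono2[of 1 _ N] by simp
    moreover have "3 + t \<le> const_factor c * (N * N ^ nesting c) + 12 * N + 9"
      using t(1) by (simp add: algebra_simps)
    ultimately have "3 + t \<le> const_factor c * (N * N ^ nesting c) + 21 * (N * N ^ nesting c)"
      by linarith
    then show ?thesis by (simp add: algebra_simps)
  qed
  ultimately show ?case using bd[of N] by auto
qed

section \<open>Square roots of girth at least six\<close>

definition common :: "nat \<Rightarrow> (nat \<Rightarrow> nat \<Rightarrow> bool) \<Rightarrow> nat \<Rightarrow> nat \<Rightarrow> nat \<Rightarrow> bool" where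
  "common N h u v w \<longleftrightarrow> w < N \<and> u \<noteq> v \<and> h u w \<and> h w v"

text \<open>
  For symmetric \<open>h\<close> the clauses say that \<open>A\<close> is the square of \<open>h\<close>, that \<open>h\<close> has no cycles of
  length three or four (at most one path of length one or two joins two vertices), and that it has
  no cycles of length five.
\<close>

definition local_root ::
  "nat \<Rightarrow> (nat \<Rightarrow> nat \<Rightarrow> bool) \<Rightarrow> nat set \<Rightarrow> (nat \<Rightarrow> nat \<Rightarrow> bool) \<Rightarrow> nat \<Rightarrow> nat \<Rightarrow> bool" where
  "local_root N A K h u v \<longleftrightarrow>
     (h u v \<longleftrightarrow> v \<in> K \<and> h v u) \<and>
     (A u v \<longleftrightarrow> h u v \<or> (\<exists>w. common N h u v w)) \<and>
     (\<forall>w w'. common N h u v w \<longrightarrow> common N h u v w' \<longrightarrow> w = w') \<and>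
     (\<forall>w. common N h u v w \<longrightarrow> \<not> h u v) \<and>
     (\<forall>w < N. h u v \<longrightarrow> A u w \<longrightarrow> A v w \<longrightarrow> h u w \<or> h v w)"

text \<open>Only \<open>u\<close> is confined to \<open>K\<close>. Since \<open>v\<close> ranges
  over all vertices, the first clause of \<open>local_root\<close> keeps the edges of
  \<open>h\<close> at \<open>K\<close> inside \<open>K\<close>, and the second one then makes
  \<open>K\<close> a union of components of \<open>A\<close>.\<close>

definition root_on :: "nat \<Rightarrow> (nat \<Rightarrow> nat \<Rightarrow> bool) \<Rightarrow> nat set \<Rightarrow> (nat \<Rightarrow> nat \<Rightarrow> bool) \<Rightarrow> bool" where
  "root_on N A K h \<longleftrightarrow> (\<forall>u \<in> K. \<forall>v < N. local_root N A K h u v)"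

section \<open>Unions of components and gluing of roots\<close>

locale adjacency =
  fixes N :: nat and A :: "nat \<Rightarrow> nat \<Rightarrow> bool"
  assumes sym: "\<And>u v. u < N \<Longrightarrow> v < N \<Longrightarrow> A u v \<Longrightarrow> A v u"
    and irrefl: "\<And>u. u < N \<Longrightarrow> \<not> A u u"
begin

definition closed :: "nat set \<Rightarrow> bool" where
  "closed K \<longleftrightarrow> K \<subseteq> {..<N} \<and> (\<forall>u \<in> K. \<forall>v < N. A u v \<longrightarrow> v \<in> K)"

text \<open>An \<open>A\<close>-neighbour is reached by one or two steps of \<open>h\<close>, and
  such steps do not leave \<open>K\<close>.\<close>

lemma root_on_closed:
  assumes "root_on N A K h" "K \<subseteq> {..<N}"
  shows "closed K"
  unfolding closed_def
proof (intro conjI ballI allI impI assms)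
  fix u v assume u: "u \<in> K" and v: "v < N" "A u v"
  have K: "b \<in> K" if "a \<in> K" "b < N" "h a b" for a b
    using that assms(1) by (auto simp: root_on_def local_root_def)
  have "local_root N A K h u v" using assms(1) u v by (auto simp: root_on_def)
  then have "h u v \<or> (\<exists>w<N. h u w \<and> h w v)"
    using v unfolding local_root_def common_def by blast
  then show "v \<in> K" using K u v by blast
qed

text \<open>Different attempts may find different roots for overlapping sets. The root on
  \<open>K\<close> takes precedence: edges of either root are edges of \<open>A\<close> and cannot
  cross the border of the closed set \<open>K\<close>, so within a component the two are never
  mixed.\<close>

lemma root_on_Un:
  assumes D: "root_on N A D g" "closed D" and K: "root_on N A K h" "closed K"
  shows "\<exists>f. root_on N A (D \<union> K) f"
proof
  let ?f = "\<lambda>u v. if u \<in> K then h u v else g u v"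
  have KK: "v \<in> K \<and> h v u" if "u \<in> K" "v < N" "h u v" for u v
    using that K(1) by (auto simp: root_on_def local_root_def)
  have DD: "v \<in> D \<and> g v u" if "u \<in> D" "v < N" "g u v" for u v
    using that D(1) by (auto simp: root_on_def local_root_def)
  have AK: "v \<in> K \<longleftrightarrow> u \<in> K" if "A u v" "u < N" "v < N" for u v
    using that K(2) sym unfolding closed_def by blast
  have gA: "A u v" if "u \<in> D" "v < N" "g u v" for u v
    using that D(1) by (auto simp: root_on_def local_root_def)
  have less: "u < N" if "u \<in> D \<union> K" for u
    using that D(2) K(2) by (auto simp: closed_def)
  show "root_on N A (D \<union> K) ?f"
    unfolding root_on_def
  proof (intro ballI allI impI)
    fix u v assume u: "u \<in> D \<union> K" and v: "v < N"
    show "local_root N A (D \<union> K) ?f u v"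
    proof (cases "u \<in> K")
      case True
      have c: "common N ?f u v w \<longleftrightarrow> common N h u v w" for w
        using KK True by (auto simp: common_def)
      have loc: "local_root N A K h u v" using K(1) True v by (auto simp: root_on_def)
      have "g v u \<Longrightarrow> v \<in> D \<Longrightarrow> v \<in> K"
        using gA[of v u] AK[of v u] less[of u] v u True by blast
      then have "?f u v \<longleftrightarrow> v \<in> D \<union> K \<and> ?f v u"
        using loc True unfolding local_root_def by auto
      moreover have "\<forall>w<N. ?f u v \<longrightarrow> A u w \<longrightarrow> A v w \<longrightarrow> ?f u w \<or> ?f v w"
        using loc True KK[OF True v] unfolding local_root_def by auto
      ultimately show ?thesis
        using loc True unfolding local_root_def c by (simp only: if_True) blast
    next
      case False
      then have uD: "u \<in> D" using u by simp
      have out: "w \<notin> K" if "g u w" "w < N" for w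
        using gA[OF uD that(2,1)] AK[of u w] False less[OF u] that by blast
      have c: "common N ?f u v w \<longleftrightarrow> common N g u v w" for w
        using out False by (auto simp: common_def)
      have loc: "local_root N A D g u v" using D(1) uD v by (auto simp: root_on_def)
      have "h v u \<Longrightarrow> v \<in> K \<Longrightarrow> False" using KK[of v u] less[OF u] False by blast
      then have "?f u v \<longleftrightarrow> v \<in> D \<union> K \<and> ?f v u"
        using loc False out[of v] v unfolding local_root_def by auto
      moreover have "\<forall>w<N. ?f u v \<longrightarrow> A u w \<longrightarrow> A v w \<longrightarrow> ?f u w \<or> ?f v w"
        using loc False out[of v] v unfolding local_root_def by auto
      ultimately show ?thesis
        using loc False unfolding local_root_def c by (simp only: if_False) blast
    qed
  qed
qed

end

section \<open>Distance and girth in elementary terms\<close>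

lemma distance_le_2:
  assumes "u \<noteq> v"
  shows "distance H u v \<le> 2 \<longleftrightarrow>
    u \<in> verts H \<and> v \<in> verts H \<and>
    ({u, v} \<in> edges H \<or> (\<exists>w \<in> verts H. {u, w} \<in> edges H \<and> {w, v} \<in> edges H))"
    (is "?L \<longleftrightarrow> ?R")
proof
  let ?S = "{enat (length p - 1) | p. walk H p \<and> hd p = u \<and> last p = v}"
  assume ?L
  \<comment> \<open>The infimum of the empty set is \<infinity>, so the bound yields a walk, and by
    well-ordering one that attains the infimum.\<close>
  have "?S \<noteq> {}"
  proof
    assume "?S = {}"
    then have "distance H u v = \<infinity>" unfolding distance_def by (simp only: Inf_enat_def) simp
    with \<open>?L\<close> show False by simp
  qed
  then have "Inf ?S \<in> ?S" unfolding Inf_enat_def by (auto intro: LeastI)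
  then obtain p where p: "distance H u v = enat (length p - 1)" "walk H p" "hd p = u" "last p = v"
    unfolding distance_def by blast
  with \<open>?L\<close> have len: "length p \<le> 3" by (simp add: numeral_eq_enat)
  from p have "p \<noteq> []" by (simp add: walk_def)
  moreover have "p \<noteq> [a]" for a using p assms by auto
  ultimately consider a b where "p = [a, b]" | a b c where "p = [a, b, c]"
    \<comment> \<open>The rule serves as a case split into lists with no, one, and at least two
      elements.\<close>
    using len by (cases p rule: remdups_adj.cases; cases "tl (tl p)") auto
  then show ?R
  proof cases
    case 1
    then show ?thesis using p by (auto simp: walk_def)
  next
    case (2 a b c)
    then have "{p ! 0, p ! Suc 0} \<in> edges H" "{p ! Suc 0, p ! Suc (Suc 0)} \<in> edges H"
      using p(2) by (auto simp: walk_def)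
    then show ?thesis using p 2 by (auto simp: walk_def)
  qed
next
  assume R: ?R
  have le: "distance H u v \<le> 2" if "walk H p" "hd p = u" "last p = v" "length p \<le> 3" for p
  proof -
    have "distance H u v \<le> enat (length p - 1)"
      unfolding distance_def using that by (intro Inf_lower) blast
    also have "\<dots> \<le> 2" using that(4) by (simp add: numeral_eq_enat)
    finally show ?thesis .
  qed
  from R consider "{u, v} \<in> edges H" | w where "w \<in> verts H" "{u, w} \<in> edges H" "{w, v} \<in> edges H"
    by blast
  then show ?L
  proof cases
    case 1
    then show ?thesis using R by (intro le[of "[u, v]"]) (auto simp: walk_def)
  next
    case (2 w)
    then show ?thesis using R
      by (intro le[of "[u, w, v]"]) (auto simp: walk_def nth_Cons split: nat.splits)
  qed
qed

lemma girth_ge_6_iff: "6 \<le> girth H \<longleftrightarrow> (\<forall>p. cycle H p \<longrightarrow> 6 \<le> length p)"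
  unfolding girth_def le_Inf_iff by (auto simp: numeral_eq_enat)

text \<open>Girth at least six in relational form: cycles of length three, four and five are
  excluded. Adjacent vertices differ by \<open>h_irrefl\<close>, so for a 4-cycle it is enough to
  demand distinct diagonals.\<close>

locale girth6_root = adjacency +
  fixes h :: "nat \<Rightarrow> nat \<Rightarrow> bool"
  assumes h_sym: "\<And>u v. u < N \<Longrightarrow> v < N \<Longrightarrow> h u v \<Longrightarrow> h v u"
    and square: "\<And>u v. u < N \<Longrightarrow> v < N \<Longrightarrow>
      A u v \<longleftrightarrow> u \<noteq> v \<and> (h u v \<or> (\<exists>w<N. h u w \<and> h w v))"
    and h_irrefl: "\<And>u. u < N \<Longrightarrow> \<not> h u u"
    and no3: "\<And>a b c. a < N \<Longrightarrow> b < N \<Longrightarrow> c < N \<Longrightarrow> h a b \<Longrightarrow> h b c \<Longrightarrow> h c a \<Longrightarrow> False"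
    and no4: "\<And>a b c d. a < N \<Longrightarrow> b < N \<Longrightarrow> c < N \<Longrightarrow> d < N \<Longrightarrow>
      h a b \<Longrightarrow> h b c \<Longrightarrow> h c d \<Longrightarrow> h d a \<Longrightarrow> a \<noteq> c \<Longrightarrow> b \<noteq> d \<Longrightarrow> False"
    and no5: "\<And>a b c d e. a < N \<Longrightarrow> b < N \<Longrightarrow> c < N \<Longrightarrow> d < N \<Longrightarrow> e < N \<Longrightarrow>
      h a b \<Longrightarrow> h b c \<Longrightarrow> h c d \<Longrightarrow> h d e \<Longrightarrow> h e a \<Longrightarrow> distinct [a, b, c, d, e] \<Longrightarrow> False"
begin

section \<open>Local structure of a root of girth at least six\<close>

lemma edge_adjacent: "u < N \<Longrightarrow> v < N \<Longrightarrow> h u v \<Longrightarrow> A u v"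
  using square h_irrefl by auto

lemma path_adjacent: "u < N \<Longrightarrow> v < N \<Longrightarrow> w < N \<Longrightarrow> h u w \<Longrightarrow> h w v \<Longrightarrow> u \<noteq> v \<Longrightarrow> A u v"
  using square by auto

text \<open>Otherwise \<open>w\<close> is reached from both ends of the edge \<open>u v\<close> by
  paths of length two. Equal midpoints close a triangle, distinct ones a cycle of length
  five.\<close>

lemma no_far_common:
  assumes "u < N" "v < N" "w < N" "h u v" "A u w" "A v w"
  shows "h u w \<or> h v w"
proof (rule ccontr)
  assume no: "\<not> ?thesis"
  obtain a where a: "a < N" "h u a" "h a w" "u \<noteq> w"
    using square[of u w] no assms by auto
  obtain b where b: "b < N" "h v b" "h b w" "v \<noteq> w"
    using square[of v w] no assms by auto
  note ab = a b
  have sy: "h a u" "h b v" "h w b" "h w a" "h v u" using ab assms h_sym by auto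
  show False
  proof (cases "a = b")
    case True
    then show ?thesis using no3[of u v a] assms ab sy by blast
  next
    case False
    have "a \<noteq> v" "b \<noteq> u" "u \<noteq> v" "a \<noteq> u" "b \<noteq> v" "w \<noteq> a" "w \<noteq> b"
      using no ab h_irrefl assms by auto
    then show ?thesis using no5[of u v b w a] assms ab sy False by auto
  qed
qed

text \<open>This is the rule of propagation: the neighbourhood of \<open>u\<close> and the relation
  \<open>A\<close> determine the neighbourhood of \<open>v\<close>. A neighbour \<open>w\<close> of
  \<open>v\<close> other than \<open>u\<close> is \<open>A\<close>-adjacent to \<open>u\<close>
  through \<open>v\<close>, and not \<open>h\<close>-adjacent to it for want of triangles; the
  converse is \<open>no_far_common\<close>.\<close>

lemma neighbours_step:
  assumes "u < N" "v < N" "w < N" "h u v"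
  shows "h v w \<longleftrightarrow> w = u \<or> A u w \<and> A v w \<and> \<not> h u w"
proof
  assume vw: "h v w"
  show "w = u \<or> A u w \<and> A v w \<and> \<not> h u w"
  proof (cases "w = u")
    case False
    moreover have "\<not> h u w" using no3[of u v w] assms vw h_sym by blast
    ultimately show ?thesis using assms vw edge_adjacent path_adjacent[of u w v] by blast
  qed simp
next
  assume "w = u \<or> A u w \<and> A v w \<and> \<not> h u w"
  then show "h v w" using no_far_common assms h_sym by blast
qed

text \<open>An \<open>A\<close>-edge from \<open>u\<close> to \<open>v\<close> would be an
  \<open>h\<close>-edge, closing a 4-cycle with \<open>x\<close> and \<open>y\<close>, or a path
  through some \<open>m\<close>. That path closes a 5-cycle, or a triangle if \<open>m\<close> is
  \<open>x\<close> or \<open>y\<close>.\<close>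

lemma no_cross:
  assumes "x < N" "y < N" "u < N" "v < N" "h x y" "h x u" "h y v" "u \<noteq> y" "v \<noteq> x"
  shows "u \<noteq> v" "\<not> A u v"
proof -
  have s: "h y x" "h u x" "h v y" using assms h_sym by auto
  show uv: "u \<noteq> v" using no3[of x y v] assms s by blast
  show "\<not> A u v"
  proof
    assume "A u v"
    then consider "h u v" | m where "m < N" "h u m" "h m v" using square assms by blast
    then show False
    proof cases
      case 1
      then show ?thesis using no4[of x y v u] assms s h_sym by blast
    next
      case (2 m)
      have "m \<noteq> x" using no3[of x y v] assms s 2 h_sym by blast
      moreover have "m \<noteq> y" using no3[of x y u] assms s 2 h_sym by blast
      moreover have "distinct [x, y, v, u]" using assms uv h_irrefl by auto
      moreover have "m \<noteq> u" "m \<noteq> v" using 2 h_irrefl assms by auto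
      moreover have "h v m" "h m u" using 2 h_sym assms by auto
      ultimately show ?thesis using no5[of x y v m u] assms s 2 by auto
    qed
  qed
qed

lemma common_split:
  assumes "x < N" "y < N" "h x y" "w < N"
  shows "A x w \<and> A y w \<longleftrightarrow> h x w \<and> w \<noteq> y \<or> h y w \<and> w \<noteq> x"
  using assms no_far_common[of x y w] edge_adjacent path_adjacent irrefl h_sym by metis

text \<open>The other neighbours of \<open>x\<close> form a clique in \<open>A\<close> through
  \<open>x\<close>, those of \<open>y\<close> one through \<open>y\<close>, and
  \<open>no_cross\<close> forbids edges in between. So any common neighbour \<open>a\<close>,
  together with its \<open>A\<close>-neighbours, singles out the clique it belongs to.\<close>

lemma neighbours_edge:
  assumes "x < N" "y < N" "h x y" and a: "a < N" "A x a" "A y a"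
  shows "h x a \<Longrightarrow> \<forall>w<N. h x w \<longleftrightarrow> w = y \<or> A x w \<and> A y w \<and> (w = a \<or> A w a)"
    and "h y a \<Longrightarrow> \<forall>w<N. h x w \<longleftrightarrow> w = y \<or> A x w \<and> A y w \<and> \<not> (w = a \<or> A w a)"
proof -
  have yx: "h y x" using assms h_sym by blast
  have ne: "a \<noteq> x" "a \<noteq> y" using a irrefl assms by auto
  {
    assume xa: "h x a"
    show "\<forall>w<N. h x w \<longleftrightarrow> w = y \<or> A x w \<and> A y w \<and> (w = a \<or> A w a)"
    proof (intro allI impI)
      fix w assume w: "w < N"
      have "w = a \<or> A w a" if "h x w" using that w xa assms path_adjacent h_sym by blast
      moreover have "\<not> (w = a \<or> A w a)" if "h y w" "w \<noteq> x"
        using no_cross[of x y a w] that w xa assms ne sym by blast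
      ultimately show "h x w \<longleftrightarrow> w = y \<or> A x w \<and> A y w \<and> (w = a \<or> A w a)"
        using common_split[OF assms(1-3) w] assms(3) by blast
    qed
  next
    assume ya: "h y a"
    show "\<forall>w<N. h x w \<longleftrightarrow> w = y \<or> A x w \<and> A y w \<and> \<not> (w = a \<or> A w a)"
    proof (intro allI impI)
      fix w assume w: "w < N"
      have "w = a \<or> A w a" if "h y w" using that w ya assms path_adjacent h_sym by blast
      moreover have "\<not> (w = a \<or> A w a)" if "h x w" "w \<noteq> y"
        using no_cross[of x y w a] that w ya assms ne sym by blast
      ultimately show "h x w \<longleftrightarrow> w = y \<or> A x w \<and> A y w \<and> \<not> (w = a \<or> A w a)"
        using common_split[OF assms(1-3) w] assms(3) by blast
    qed
  }
qed

text \<open>Propagation guarantees correct rows only for vertices of \<open>K\<close>. This suffices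
  because \<open>h\<close>-edges at \<open>K\<close> end in \<open>K\<close>, so every entry of
  \<open>g\<close> that decides \<open>local_root\<close> lies in such a row.\<close>

lemma root_on_rows:
  assumes K: "K \<subseteq> {..<N}" and rows: "\<And>u w. u \<in> K \<Longrightarrow> w < N \<Longrightarrow> g u w \<longleftrightarrow> h u w"
    and closed: "\<And>u w. u \<in> K \<Longrightarrow> w < N \<Longrightarrow> h u w \<Longrightarrow> w \<in> K"
  shows "root_on N A K g"
  unfolding root_on_def
proof (intro ballI allI impI)
  fix u v assume u: "u \<in> K" and v: "v < N"
  then have uN: "u < N" using K by auto
  have c: "common N g u v w \<longleftrightarrow> common N h u v w" for w
    using rows closed u v by (auto simp: common_def)
  have "local_root N A K h u v"
    unfolding local_root_def
  proof (intro conjI allI impI)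
    show "h u v \<longleftrightarrow> v \<in> K \<and> h v u" using closed h_sym u v uN by blast
    show "A u v \<longleftrightarrow> h u v \<or> (\<exists>w. common N h u v w)"
      using square[OF uN v] h_irrefl uN by (auto simp: common_def)
    show "w = w'" if "common N h u v w" "common N h u v w'" for w w'
      using that no4[of u w v w'] h_sym uN v by (auto simp: common_def)
    show "\<not> h u v" if "common N h u v w" for w
      using that no3[of u w v] h_sym[of u v] uN v unfolding common_def by blast
    show "h u w \<or> h v w" if "w < N" "h u v" "A u w" "A v w" for w
      using that no_far_common uN v by blast
  qed
  moreover have "g u v \<longleftrightarrow> h u v" "\<forall>w<N. g u w \<longleftrightarrow> h u w" "v \<in> K \<longrightarrow> (g v u \<longleftrightarrow> h v u)"
    "h u v \<longrightarrow> (\<forall>w<N. g v w \<longleftrightarrow> h v w)"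
    using u v uN rows closed by auto
  ultimately show "local_root N A K g u v"
    unfolding local_root_def c by simp blast
qed

end

section \<open>Translation between graphs and relations\<close>

lemma girth6_root_of_square:
  assumes H: "simple_graph H" "6 \<le> girth H" "G = square H" and G: "verts G = {0..<N}"
  shows "girth6_root N (\<lambda>u v. {u, v} \<in> edges G) (\<lambda>u v. {u, v} \<in> edges H)"
proof -
  have VH: "verts H = {0..<N}" using assms by (simp add: square_def)
  have ne: "u \<noteq> v" if "{u, v} \<in> edges H" for u v
    using that H(1) by (fastforce simp: simple_graph_def)
  have edge: "{u, v} \<in> edges G \<longleftrightarrow>
      u \<noteq> v \<and> ({u, v} \<in> edges H \<or> (\<exists>w<N. {u, w} \<in> edges H \<and> {w, v} \<in> edges H))"
    if "u < N" "v < N" for u v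
  proof -
    have "{u, v} \<in> edges G \<longleftrightarrow> u \<noteq> v \<and> distance H u v \<le> 2"
    proof
      assume "{u, v} \<in> edges G"
      then obtain a b where ab: "{u, v} = {a, b}" "a < N" "b < N" "a \<noteq> b" "distance H a b \<le> 2"
        unfolding H(3) square_def VH by auto
      \<comment> \<open>The edge may have been listed with its ends exchanged, so the bound on the
        distance has to be turned around.\<close>
      then have "distance H b a \<le> 2" using distance_le_2[of a b H] distance_le_2[of b a H]
        by (auto simp: insert_commute)
      with ab show "u \<noteq> v \<and> distance H u v \<le> 2" by (auto simp: doubleton_eq_iff)
    qed (use that in \<open>auto simp: H(3) square_def VH\<close>)
    then show ?thesis using distance_le_2[of u v H] that VH by auto
  qed
  have cyc: False if "cycle H p" "length p < 6" for p
    using that H(2) by (auto simp: girth_ge_6_iff)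
  show ?thesis
  proof
    fix a b c assume *: "a < N" "b < N" "c < N" "{a, b} \<in> edges H" "{b, c} \<in> edges H" "{c, a} \<in> edges H"
    have "cycle H [a, b, c]" using * ne VH
      by (auto simp: cycle_def walk_def nth_Cons split: nat.splits)
    then show False using cyc by force
  next
    fix a b c d assume *: "a < N" "b < N" "c < N" "d < N" "{a, b} \<in> edges H" "{b, c} \<in> edges H"
      "{c, d} \<in> edges H" "{d, a} \<in> edges H" "a \<noteq> c" "b \<noteq> d"
    have "cycle H [a, b, c, d]" using * ne VH
      by (auto simp: cycle_def walk_def nth_Cons split: nat.splits)
    then show False using cyc by force
  next
    fix a b c d e assume *: "a < N" "b < N" "c < N" "d < N" "e < N" "{a, b} \<in> edges H"
      "{b, c} \<in> edges H" "{c, d} \<in> edges H" "{d, e} \<in> edges H" "{e, a} \<in> edges H"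
      "distinct [a, b, c, d, e]"
    have "cycle H [a, b, c, d, e]" using * VH
      by (auto simp: cycle_def walk_def nth_Cons split: nat.splits)
    then show False using cyc by force
  qed (use edge ne edge[of u u for u] ne[of u u for u] in \<open>auto simp: insert_commute\<close>)
qed

text \<open>A triangle has a path of length two beside an edge, and a 4-cycle has two midpoints for
  one diagonal. In a 5-cycle \<open>a b c d e\<close>, the vertex \<open>d\<close> is
  \<open>A\<close>-adjacent to both ends of \<open>a b\<close>; the last clause of
  \<open>local_root\<close> then gives a chord, which closes a triangle.\<close>

lemma root_on_imp_square:
  assumes G: "simple_graph G" "verts G = {0..<N}"
    and h: "root_on N (\<lambda>u v. {u, v} \<in> edges G) {..<N} h"
  shows "\<exists>H. simple_graph H \<and> 6 \<le> girth H \<and> G = square H"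
proof -
  let ?A = "\<lambda>u v. {u, v} \<in> edges G"
  let ?H = "({0..<N}, {{u, v} | u v. u < N \<and> v < N \<and> h u v})"
  have loc: "local_root N ?A {..<N} h u v" if "u < N" "v < N" for u v
    using h that by (auto simp: root_on_def)
  have sy: "h v u" if "u < N" "v < N" "h u v" for u v
    using loc that by (auto simp: local_root_def)
  have hA: "?A u v" if "u < N" "v < N" "h u v" for u v
    using loc that by (auto simp: local_root_def)
  have Gne: "u \<noteq> v" if "?A u v" for u v
    using that G(1) by (fastforce simp: simple_graph_def)
  have edge: "{u, v} \<in> edges ?H \<longleftrightarrow> u < N \<and> v < N \<and> h u v" for u v
    using sy by (auto simp: doubleton_eq_iff)
  have simple: "simple_graph ?H"
    using hA Gne by (fastforce simp: simple_graph_def)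
  have unique: "w = w'" if "common N h u v w" "common N h u v w'" "u < N" "v < N" for u v w w'
    using loc[of u v] that unfolding local_root_def by blast
  have tri: False if "h a b" "h b c" "h c a" "a < N" "b < N" "c < N" for a b c
  proof -
    have "common N h a b c" using that sy Gne[OF hA, of a b] by (auto simp: common_def)
    then show False using loc[of a b] that unfolding local_root_def by blast
  qed
  have "6 \<le> length p" if "cycle ?H p" for p
  proof (rule ccontr)
    have step: "h (p ! i) (p ! Suc i) \<and> p ! i < N \<and> p ! Suc i < N" if "Suc i < length p" for i
      using \<open>cycle ?H p\<close> that edge unfolding cycle_def walk_def by blast
    have last: "h (last p) (hd p)"
      using \<open>cycle ?H p\<close> edge unfolding cycle_def by blast
    assume "\<not> 6 \<le> length p"
    moreover have "3 \<le> length p" using that by (simp add: cycle_def)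
    ultimately consider "length p = 3" | "length p = 4" | "length p = 5" by linarith
    then show False
    proof cases
      case 1
      then obtain a b c where p: "p = [a, b, c]" by (auto simp: length_Suc_conv numeral_eq_Suc)
      have "h a b" "h b c" "h c a" "a < N" "b < N" "c < N"
        using step[of 0] step[of 1] step[of 2] step[of 3] last unfolding p by auto
      then show False using tri by blast
    next
      case 2
      then obtain a b c d where p: "p = [a, b, c, d]" by (auto simp: length_Suc_conv numeral_eq_Suc)
      have "h a b" "h b c" "h c d" "h d a" "a < N" "b < N" "c < N" "d < N"
        using step[of 0] step[of 1] step[of 2] step[of 3] last unfolding p by auto
      moreover have "a \<noteq> c" "b \<noteq> d" using that unfolding p cycle_def by auto
      ultimately show False using unique[of a c b d] sy[of d a] sy[of c d] by (auto simp: common_def)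
    next
      case 3
      then obtain a b c d e where p: "p = [a, b, c, d, e]" by (auto simp: length_Suc_conv numeral_eq_Suc)
      have *: "h a b" "h b c" "h c d" "h d e" "h e a" "a < N" "b < N" "c < N" "d < N" "e < N"
        using step[of 0] step[of 1] step[of 2] step[of 3] last unfolding p by auto
      have d: "distinct [a, b, c, d, e]" using that unfolding p cycle_def by auto
      have "common N h a d e" "common N h b d c"
        using * d sy[of d e] sy[of e a] by (auto simp: common_def)
      then have "?A a d" "?A b d"
        using loc[of a d] loc[of b d] * unfolding local_root_def by blast+
      then consider "h a d" | "h b d" using loc[of a b] * unfolding local_root_def by blast
      then show False
        using tri[of a d e] tri[of b c d] * sy by cases blast+
    qed
  qed
  then have girth: "6 \<le> girth ?H" by (simp add: girth_ge_6_iff)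
  have "edges (square ?H) = edges G"
  proof (intro set_eqI iffI)
    fix e assume "e \<in> edges (square ?H)"
    then obtain u v where uv: "e = {u, v}" "u < N" "v < N" "u \<noteq> v" "distance ?H u v \<le> 2"
      unfolding square_def by auto
    then have "h u v \<or> (\<exists>w<N. h u w \<and> h w v)"
      unfolding distance_le_2[OF uv(4)] edge by auto
    then show "e \<in> edges G" using loc[OF uv(2,3)] uv(1,4) by (auto simp: local_root_def common_def)
  next
    fix e assume e: "e \<in> edges G"
    then obtain u v where uv: "e = {u, v}" "u \<noteq> v"
      using G(1) by (fastforce simp: simple_graph_def card_2_iff)
    with e have N: "u < N" "v < N" using G by (auto simp: simple_graph_def)
    then have "h u v \<or> (\<exists>w<N. h u w \<and> h w v)"
      using loc[OF N] uv e by (auto simp: local_root_def common_def)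
    then have "distance ?H u v \<le> 2" unfolding distance_le_2[OF uv(2)] edge using N by auto
    then show "e \<in> edges (square ?H)" unfolding square_def using uv N by auto
  qed
  then have "G = square ?H" using G(2) by (cases G) (simp add: square_def)
  then show ?thesis using simple girth by blast
qed

section \<open>The program\<close>

definition And :: "expr \<Rightarrow> expr \<Rightarrow> expr" where
  "And e f = Less (Const 0) (Times e f)"

definition Or :: "expr \<Rightarrow> expr \<Rightarrow> expr" where
  "Or e f = Less (Const 0) (Plus e f)"

definition Neg :: "expr \<Rightarrow> expr" where
  "Neg e = Equal e (Const 0)"

text \<open>The negations normalise the operands, since truth may be represented by any positive
  number.\<close>

definition Iff :: "expr \<Rightarrow> expr \<Rightarrow> expr" where
  "Iff e f = Equal (Neg e) (Neg f)"

definition holds :: "expr \<Rightarrow> memory \<Rightarrow> bool" where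
  "holds e s \<longleftrightarrow> 0 < val e s"

lemma holds_simps [simp]:
  "holds (And e f) s \<longleftrightarrow> holds e s \<and> holds f s"
  "holds (Or e f) s \<longleftrightarrow> holds e s \<or> holds f s"
  "holds (Neg e) s \<longleftrightarrow> \<not> holds e s"
  "holds (Iff e f) s \<longleftrightarrow> (holds e s \<longleftrightarrow> holds f s)"
  "holds (Equal e f) s \<longleftrightarrow> val e s = val f s"
  "holds (Elem x e) s \<longleftrightarrow> 0 < s x (val e s)"
  by (auto simp: holds_def And_def Or_def Neg_def Iff_def)

lemma sem_LCond: "sem N (LCond b c d) s = (if holds b s then sem N c s else sem N d s)"
  by (simp add: holds_def)

abbreviation assign :: "string \<Rightarrow> expr \<Rightarrow> loop_prog" where
  "assign x e \<equiv> LAssign x (Const 0) e"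

abbreviation cell :: "string \<Rightarrow> expr \<Rightarrow> expr \<Rightarrow> expr" where
  "cell x i j \<equiv> Elem x (Plus (Times i (Var ''n'')) j)"

section \<open>Constructing a candidate root\<close>

definition set_row :: "expr \<Rightarrow> expr \<Rightarrow> loop_prog" where
  "set_row i e = LFor ''w'' (LAssign ''h'' (Plus (Times i (Var ''n'')) (Var ''w'')) e)"

text \<open>The operand \<open>b\<close> guesses whether \<open>a\<close> belongs to the clique of
  \<open>x\<close>. Testing adjacency of \<open>x\<close> and \<open>y\<close> keeps the row of an
  isolated vertex empty, where \<open>select_edge\<close> leaves \<open>x\<close> equal to
  \<open>y\<close>.\<close>

definition start_entry :: "expr \<Rightarrow> expr" where
  "start_entry b =
     Or (And (cell ''adj'' (Var ''x'') (Var ''y'')) (Equal (Var ''w'') (Var ''y'')))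
        (And (And (cell ''adj'' (Var ''x'') (Var ''w'')) (cell ''adj'' (Var ''y'') (Var ''w'')))
             (Iff b (Or (Equal (Var ''w'') (Var ''a'')) (cell ''adj'' (Var ''w'') (Var ''a'')))))"

text \<open>Each attempt resets \<open>known\<close> but lets old rows of \<open>h\<close> stand: by
  \<open>root_on_rows\<close> only the rows of known vertices have to be right.\<close>

definition start :: "expr \<Rightarrow> loop_prog" where
  "start b =
     LFor ''u'' (LAssign ''known'' (Var ''u'') (Equal (Var ''u'') (Var ''x''))) ;;
     set_row (Var ''x'') (start_entry b)"

definition find_parent :: loop_prog where
  "find_parent =
     assign ''f'' (Const 0) ;;
     LFor ''p'' (LCond (And (Elem ''known'' (Var ''p'')) (cell ''h'' (Var ''p'') (Var ''u'')))
       (assign ''q'' (Var ''p'') ;; assign ''f'' (Const 1))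
       LSkip)"

text \<open>The formula of \<open>neighbours_step\<close>, with the known vertex \<open>q\<close> in
  the role of \<open>u\<close> there and the new vertex \<open>u\<close> in the role of
  \<open>v\<close>.\<close>

definition next_entry :: expr where
  "next_entry =
     Or (Equal (Var ''w'') (Var ''q''))
        (And (And (cell ''adj'' (Var ''u'') (Var ''w'')) (cell ''adj'' (Var ''q'') (Var ''w'')))
             (Neg (cell ''h'' (Var ''q'') (Var ''w''))))"

definition visit :: loop_prog where
  "visit =
     find_parent ;;
     LCond (And (Var ''f'') (Neg (Elem ''known'' (Var ''u''))))
       (set_row (Var ''u'') next_entry ;; LAssign ''known'' (Var ''u'') (Const 1))
       LSkip"

definition propagate :: loop_prog where
  "propagate = LFor ''r'' (LFor ''u'' visit)"

text \<open>
  The flag \<open>c\<close> records whether a path of length one or two from \<open>u\<close> to \<open>v\<close> has been found;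
  finding another one is an error.
\<close>

definition check_triple :: loop_prog where
  "check_triple =
     LCond (And (Neg (Equal (Var ''u'') (Var ''v'')))
             (And (cell ''h'' (Var ''u'') (Var ''w'')) (cell ''h'' (Var ''w'') (Var ''v''))))
       (LCond (Var ''c'') (assign ''ok'' (Const 0)) LSkip ;; assign ''c'' (Const 1))
       LSkip ;;
     LCond (And (And (cell ''h'' (Var ''u'') (Var ''v''))
               (And (cell ''adj'' (Var ''u'') (Var ''w'')) (cell ''adj'' (Var ''v'') (Var ''w''))))
             (And (Neg (cell ''h'' (Var ''u'') (Var ''w''))) (Neg (cell ''h'' (Var ''v'') (Var ''w'')))))
       (assign ''ok'' (Const 0))
       LSkip"

definition check_pair :: loop_prog where
  "check_pair =
     assign ''c'' (cell ''h'' (Var ''u'') (Var ''v'')) ;;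
     LFor ''w'' check_triple ;;
     LCond (And (Iff (Var ''c'') (cell ''adj'' (Var ''u'') (Var ''v'')))
             (Iff (cell ''h'' (Var ''u'') (Var ''v''))
                (And (Elem ''known'' (Var ''v'')) (cell ''h'' (Var ''v'') (Var ''u'')))))
       LSkip
       (assign ''ok'' (Const 0))"

definition check :: loop_prog where
  "check =
     assign ''ok'' (Const 1) ;;
     LFor ''u'' (LCond (Elem ''known'' (Var ''u'')) (LFor ''v'' check_pair) LSkip)"

definition mark :: loop_prog where
  "mark =
     LFor ''u'' (LCond (And (Var ''ok'') (Elem ''known'' (Var ''u'')))
       (LAssign ''done'' (Var ''u'') (Const 1))
       LSkip)"

definition attempt :: "expr \<Rightarrow> loop_prog" where
  "attempt b = start b ;; propagate ;; check ;; mark"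

text \<open>Each scan keeps its last hit, so \<open>x\<close> becomes the largest neighbour of
  \<open>y\<close>. An isolated \<open>y\<close> is paired with itself. If there is no common
  neighbour, \<open>a\<close> keeps the default \<open>x\<close>, a value without effect because the
  clause of \<open>start_entry\<close> that contains \<open>a\<close> is then false.\<close>

definition select_edge :: loop_prog where
  "select_edge =
     assign ''x'' (Var ''y'') ;;
     LFor ''w'' (LCond (cell ''adj'' (Var ''y'') (Var ''w'')) (assign ''x'' (Var ''w'')) LSkip) ;;
     assign ''a'' (Var ''x'') ;;
     LFor ''w'' (LCond (And (cell ''adj'' (Var ''x'') (Var ''w'')) (cell ''adj'' (Var ''y'') (Var ''w'')))
       (assign ''a'' (Var ''w''))
       LSkip)"

definition try_vertex :: loop_prog where
  "try_vertex = select_edge ;; attempt (Const 0) ;; attempt (Const 1)"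

definition main :: loop_prog where
  "main =
     LFor ''y'' try_vertex ;;
     assign ''out'' (Const 1) ;;
     LFor ''u'' (LCond (Elem ''done'' (Var ''u'')) LSkip (assign ''out'' (Const 0)))"

lemmas expr_defs = And_def Or_def Neg_def Iff_def start_entry_def next_entry_def
lemmas prog_defs = set_row_def start_def find_parent_def visit_def propagate_def check_triple_def
  check_pair_def check_def mark_def attempt_def select_edge_def try_vertex_def main_def

lemma wf_main: "wf_prog main"
  by (simp add: prog_defs expr_defs)

text \<open>Inside the loop over \<open>y\<close>, propagation nests three loops (rounds, vertices,
  and parents or row entries), and so does the check of all triples.\<close>

lemma nesting_main: "nesting main = 4"
  by (simp add: prog_defs)

section \<open>Correctness of the program\<close>

text \<open>Uniqueness of quotient and remainder modulo \<open>N\<close>.\<close>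

lemma index_eq_iff:
  fixes N :: nat
  assumes "w < N" "w' < N"
  shows "u * N + w = u' * N + w' \<longleftrightarrow> u = u' \<and> w = w'"
proof
  assume eq: "u * N + w = u' * N + w'"
  then have "(u * N + w) div N = (u' * N + w') div N" by simp
  then have "u = u'" using assms by simp
  with eq show "u = u' \<and> w = w'" by simp
qed simp

section \<open>Matrices and vertex sets stored in memory\<close>

definition entry :: "nat \<Rightarrow> memory \<Rightarrow> nat \<Rightarrow> nat \<Rightarrow> bool" where
  "entry N s u v \<longleftrightarrow> 0 < s ''h'' (u * N + v)"

definition marked :: "nat \<Rightarrow> memory \<Rightarrow> string \<Rightarrow> nat set" where
  "marked N s x = {v. v < N \<and> 0 < s x v}"

lemma entry_cong: "s ''h'' = s' ''h'' \<Longrightarrow> entry N s = entry N s'"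
  by (simp add: entry_def fun_eq_iff)

lemma marked_cong: "s x = s' x \<Longrightarrow> marked N s x = marked N s' x"
  by (simp add: marked_def)

lemma marked_subset: "marked N s x \<subseteq> {..<N}"
  by (auto simp: marked_def)

text \<open>The expression \<open>E\<close> may read the matrix while it is being overwritten. The
  last assumption within \<open>ent\<close> therefore grants the old entries of all rows other than
  \<open>u\<close>.\<close>

lemma set_row_entry:
  assumes n: "s ''n'' 0 = N"
    and row: "\<And>s'. (\<And>z. z \<noteq> ''w'' \<Longrightarrow> z \<noteq> ''h'' \<Longrightarrow> s' z = s z) \<Longrightarrow> val e s' = u"
    and ent: "\<And>s' w. w < N \<Longrightarrow> s' ''w'' 0 = w \<Longrightarrow>
      (\<And>z. z \<noteq> ''w'' \<Longrightarrow> z \<noteq> ''h'' \<Longrightarrow> s' z = s z) \<Longrightarrow>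
      (\<And>i w. w < N \<Longrightarrow> i \<noteq> u \<Longrightarrow> entry N s' i w = entry N s i w) \<Longrightarrow>
      holds E s' \<longleftrightarrow> P w"
    and w: "w < N"
  shows "entry N (sem N (set_row e E) s) i w \<longleftrightarrow> (if i = u then P w else entry N s i w)"
proof -
  let ?c = "LAssign ''h'' (Plus (Times e (Var ''n'')) (Var ''w'')) E"
  let ?I = "\<lambda>k s'. \<forall>i w. w < N \<longrightarrow>
    (entry N s' i w \<longleftrightarrow> (if i = u \<and> w < k then P w else entry N s i w))"
  have "?I N (sem N (LFor ''w'' ?c) s)"
  proof (rule sem_For_induct[where P = ?I])
    fix k s'
    assume k: "k < N" and I: "?I k s'" and cnt: "s' ''w'' 0 = k"
      and "\<And>z. z \<noteq> ''w'' \<Longrightarrow> z \<notin> writes ?c \<Longrightarrow> s' z = s z"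
    then have fr: "\<And>z. z \<noteq> ''w'' \<Longrightarrow> z \<noteq> ''h'' \<Longrightarrow> s' z = s z" by auto
    have E: "holds E s' \<longleftrightarrow> P k" using ent[OF k cnt fr] I by auto
    have "val e s' = u" using row[OF fr] .
    then have sem: "sem N ?c s' ''h'' = (s' ''h'')(u * N + k := val E s')"
      using fr[of "''n''"] n cnt by (simp add: upd_apply)
    show "?I (Suc k) (sem N ?c s')"
    proof (intro allI impI)
      fix i w assume w: "w < N"
      show "entry N (sem N ?c s') i w \<longleftrightarrow> (if i = u \<and> w < Suc k then P w else entry N s i w)"
      proof (cases "i = u \<and> w = k")
        case True
        then show ?thesis using E unfolding entry_def sem by (simp add: holds_def)
      next
        case False
        then have "i * N + w \<noteq> u * N + k" using index_eq_iff[OF w k] by blast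
        then have "entry N (sem N ?c s') i w = entry N s' i w" unfolding entry_def sem by simp
        then show ?thesis using I w False by (auto simp: less_Suc_eq)
      qed
    qed
  qed (simp_all add: entry_def upd_apply)
  then show ?thesis using w by (simp add: set_row_def)
qed

section \<open>The start row and a single visit\<close>

context adjacency
begin

definition encodes :: "memory \<Rightarrow> bool" where
  "encodes s \<longleftrightarrow> s ''n'' 0 = N \<and> (\<forall>u<N. \<forall>v<N. 0 < s ''adj'' (u * N + v) \<longleftrightarrow> A u v)"

lemma encodes_cong: "encodes s \<Longrightarrow> s' ''n'' = s ''n'' \<Longrightarrow> s' ''adj'' = s ''adj'' \<Longrightarrow> encodes s'"
  by (simp add: encodes_def)

lemma encodes_n: "encodes s \<Longrightarrow> s ''n'' 0 = N"
  by (simp add: encodes_def)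

lemma encodes_adj: "encodes s \<Longrightarrow> u < N \<Longrightarrow> v < N \<Longrightarrow> 0 < s ''adj'' (u * N + v) \<longleftrightarrow> A u v"
  by (simp add: encodes_def)

text \<open>If \<open>x y\<close> is an edge of the root and \<open>a\<close> a common neighbour,
  these are the two formulas of \<open>neighbours_edge\<close>, the first one for \<open>b\<close>
  true.\<close>

definition start_row :: "bool \<Rightarrow> nat \<Rightarrow> nat \<Rightarrow> nat \<Rightarrow> nat \<Rightarrow> bool" where
  "start_row b x y a w \<longleftrightarrow>
     A x y \<and> w = y \<or> A x w \<and> A y w \<and> (b \<longleftrightarrow> w = a \<or> A w a)"

lemma sem_start:
  assumes s: "encodes s" and lt: "s ''x'' 0 < N" "s ''y'' 0 < N" "s ''a'' 0 < N"
    and b: "\<And>s. holds b s \<longleftrightarrow> \<beta>"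
  shows "marked N (sem N (start b) s) ''known'' = {s ''x'' 0}"
    and "w < N \<Longrightarrow> entry N (sem N (start b) s) (s ''x'' 0) w \<longleftrightarrow>
      start_row \<beta> (s ''x'' 0) (s ''y'' 0) (s ''a'' 0) w"
proof -
  let ?c = "LAssign ''known'' (Var ''u'') (Equal (Var ''u'') (Var ''x''))"
  let ?s = "sem N (LFor ''u'' ?c) s"
  let ?I = "\<lambda>k s'. \<forall>v<k. 0 < s' ''known'' v \<longleftrightarrow> v = s ''x'' 0"
  have "?I N ?s"
  proof (rule sem_For_induct[where P = ?I])
    fix k s'
    assume "k < N" "?I k s'" "s' ''u'' 0 = k" "\<And>z. z \<noteq> ''u'' \<Longrightarrow> z \<notin> writes ?c \<Longrightarrow> s' z = s z"
    then show "?I (Suc k) (sem N ?c s')" by (auto simp: upd_apply less_Suc_eq)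
  qed (simp_all add: upd_apply)
  then have K: "marked N ?s ''known'' = {s ''x'' 0}" using lt by (auto simp: marked_def)
  have fr: "?s z = s z" if "z \<noteq> ''u''" "z \<noteq> ''known''" for z
    using that by (intro sem_frame) simp
  have sem: "sem N (start b) s = sem N (set_row (Var ''x'') (start_entry b)) ?s"
    by (simp add: start_def)
  have "sem N (start b) s ''known'' = ?s ''known''"
    unfolding sem by (rule sem_frame) (simp add: set_row_def)
  then show "marked N (sem N (start b) s) ''known'' = {s ''x'' 0}" using K by (simp add: marked_def)
  show "entry N (sem N (start b) s) (s ''x'' 0) w \<longleftrightarrow>
      start_row \<beta> (s ''x'' 0) (s ''y'' 0) (s ''a'' 0) w" if "w < N"
    unfolding sem
  proof (subst set_row_entry[where u = "s ''x'' 0" and N = N and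
        P = "start_row \<beta> (s ''x'' 0) (s ''y'' 0) (s ''a'' 0)"])
    show "?s ''n'' 0 = N" using fr s by (simp add: encodes_n)
    fix s' assume f: "\<And>z. z \<noteq> ''w'' \<Longrightarrow> z \<noteq> ''h'' \<Longrightarrow> s' z = ?s z"
    show "val (Var ''x'') s' = s ''x'' 0" using f fr by simp
  next
    fix s' w assume f: "\<And>z. z \<noteq> ''w'' \<Longrightarrow> z \<noteq> ''h'' \<Longrightarrow> s' z = ?s z"
      and w: "w < N" "s' ''w'' 0 = w"
    have "s' ''x'' = s ''x''" "s' ''y'' = s ''y''" "s' ''a'' = s ''a''" "s' ''adj'' = s ''adj''"
      "s' ''n'' = s ''n''" using f fr by auto
    then show "holds (start_entry b) s' \<longleftrightarrow> start_row \<beta> (s ''x'' 0) (s ''y'' 0) (s ''a'' 0) w"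
      using w lt s by (simp add: start_entry_def start_row_def b encodes_n encodes_adj)
  qed (use that in auto)
qed

lemma sem_find_parent:
  fixes s :: memory
  assumes s: "encodes s" and u: "s ''u'' 0 < N"
  defines "s' \<equiv> sem N find_parent s"
  shows "0 < s' ''f'' 0 \<longleftrightarrow> (\<exists>p \<in> marked N s ''known''. entry N s p (s ''u'' 0))"
    and "0 < s' ''f'' 0 \<Longrightarrow> s' ''q'' 0 \<in> marked N s ''known'' \<and> entry N s (s' ''q'' 0) (s ''u'' 0)"
proof -
  let ?c = "LCond (And (Elem ''known'' (Var ''p'')) (cell ''h'' (Var ''p'') (Var ''u'')))
    (assign ''q'' (Var ''p'') ;; assign ''f'' (Const 1)) LSkip"
  let ?p = "\<lambda>p. p \<in> marked N s ''known'' \<and> entry N s p (s ''u'' 0)"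
  let ?s = "upd s ''f'' 0 0"
  let ?I = "\<lambda>k s'. (0 < s' ''f'' 0 \<longleftrightarrow> (\<exists>p<k. ?p p)) \<and> (0 < s' ''f'' 0 \<longrightarrow> ?p (s' ''q'' 0))"
  have "?I N (sem N (LFor ''p'' ?c) ?s)"
  proof (rule sem_For_induct[where P = ?I])
    fix k s'
    assume k: "k < N" and I: "?I k s'" and cnt: "s' ''p'' 0 = k"
      and fr: "\<And>z. z \<noteq> ''p'' \<Longrightarrow> z \<notin> writes ?c \<Longrightarrow> s' z = ?s z"
    have "s' ''known'' = s ''known''" "s' ''h'' = s ''h''" "s' ''u'' = s ''u''" "s' ''n'' = s ''n''"
      using fr by (auto simp: upd_apply)
    then have "holds (And (Elem ''known'' (Var ''p'')) (cell ''h'' (Var ''p'') (Var ''u''))) s' \<longleftrightarrow> ?p k"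
      using cnt k s by (simp add: encodes_n marked_def entry_def)
    then show "?I (Suc k) (sem N ?c s')"
      using I cnt unfolding sem_LCond by (auto simp: upd_apply less_Suc_eq)
  qed (simp_all add: upd_apply)
  moreover have "s' = sem N (LFor ''p'' ?c) ?s" by (simp add: s'_def find_parent_def)
  ultimately show "0 < s' ''f'' 0 \<longleftrightarrow> (\<exists>p \<in> marked N s ''known''. entry N s p (s ''u'' 0))"
    and "0 < s' ''f'' 0 \<Longrightarrow> s' ''q'' 0 \<in> marked N s ''known'' \<and> entry N s (s' ''q'' 0) (s ''u'' 0)"
    by (auto simp: marked_def)
qed

lemma sem_visit:
  fixes s :: memory
  assumes s: "encodes s" and u: "s ''u'' 0 < N"
  defines "s' \<equiv> sem N visit s" and "K \<equiv> marked N s ''known''" and "u \<equiv> s ''u'' 0"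
  shows "\<lbrakk>u \<in> K \<or> \<not> (\<exists>p \<in> K. entry N s p u)\<rbrakk> \<Longrightarrow>
      marked N s' ''known'' = K \<and> (\<forall>i. \<forall>w<N. entry N s' i w = entry N s i w)"
    and "\<lbrakk>u \<notin> K; \<exists>p \<in> K. entry N s p u\<rbrakk> \<Longrightarrow> \<exists>p \<in> K. entry N s p u \<and>
      marked N s' ''known'' = insert u K \<and>
      (\<forall>i. \<forall>w<N. entry N s' i w \<longleftrightarrow>
        (if i = u then w = p \<or> A u w \<and> A p w \<and> \<not> entry N s p w else entry N s i w))"
proof -
  let ?s = "sem N find_parent s"
  have fr: "?s z = s z" if "z \<noteq> ''f''" "z \<noteq> ''q''" "z \<noteq> ''p''" for z
    using that by (intro sem_frame) (simp add: find_parent_def)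
  have enc: "encodes ?s" using s by (rule encodes_cong) (simp_all add: fr)
  have ent: "entry N ?s = entry N s" by (rule entry_cong) (simp add: fr)
  have K: "marked N ?s ''known'' = K" unfolding K_def by (rule marked_cong) (simp add: fr)
  have uu: "?s ''u'' 0 = u" by (simp add: fr u_def)
  have uK: "0 < ?s ''known'' u \<longleftrightarrow> u \<in> K" using u by (simp add: fr K_def u_def marked_def)
  note par = sem_find_parent[OF s u, folded K_def u_def]
  {
    assume "u \<in> K \<or> \<not> (\<exists>p \<in> K. entry N s p u)"
    then have "s' = ?s"
      unfolding s'_def visit_def sem.simps(3) sem_LCond using par(1) uu uK by auto
    then show "marked N s' ''known'' = K \<and> (\<forall>i. \<forall>w<N. entry N s' i w = entry N s i w)"
      using ent K by simp
  next
    assume new: "u \<notin> K" "\<exists>p \<in> K. entry N s p u"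
    let ?q = "?s ''q'' 0"
    have q: "?q \<in> K" "entry N s ?q u" using par new by auto
    then have qN: "?q < N" "?q \<noteq> u" using new by (auto simp: K_def marked_def)
    let ?t = "sem N (set_row (Var ''u'') next_entry) ?s"
    have s': "s' = upd ?t ''known'' (?t ''u'' 0) 1"
      unfolding s'_def visit_def sem.simps(3) sem_LCond using par(1) uu uK new by auto
    have frt: "?t z = ?s z" if "z \<noteq> ''w''" "z \<noteq> ''h''" for z
      using that by (intro sem_frame) (simp add: set_row_def)
    have "marked N s' ''known'' = insert u K"
      using frt uu K u unfolding s' by (auto simp: upd_apply marked_def u_def)
    moreover have "entry N s' i w \<longleftrightarrow>
        (if i = u then w = ?q \<or> A u w \<and> A ?q w \<and> \<not> entry N s ?q w else entry N s i w)"
      if w: "w < N" for i w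
    proof -
      have "entry N s' = entry N ?t" unfolding s' by (rule entry_cong) (simp add: upd_apply)
      moreover have "entry N ?t i w \<longleftrightarrow>
        (if i = u then w = ?q \<or> A u w \<and> A ?q w \<and> \<not> entry N s ?q w else entry N ?s i w)"
      proof (rule set_row_entry)
        show "?s ''n'' 0 = N" "w < N" using enc w by (auto simp: encodes_n)
      next
        fix s1 assume f: "\<And>z. z \<noteq> ''w'' \<Longrightarrow> z \<noteq> ''h'' \<Longrightarrow> s1 z = ?s z"
        show "val (Var ''u'') s1 = u" using f uu by simp
      next
        fix s1 w assume f: "\<And>z. z \<noteq> ''w'' \<Longrightarrow> z \<noteq> ''h'' \<Longrightarrow> s1 z = ?s z"
          and w: "w < N" "s1 ''w'' 0 = w"
          and e: "\<And>i w. w < N \<Longrightarrow> i \<noteq> u \<Longrightarrow> entry N s1 i w = entry N ?s i w"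
        have "s1 ''u'' = ?s ''u''" "s1 ''q'' = ?s ''q''" "s1 ''adj'' = ?s ''adj''" "s1 ''n'' = ?s ''n''"
          using f by auto
        \<comment> \<open>The vertex \<open>q\<close> is known and \<open>u\<close> is not, so the
          row being read is not the one being overwritten.\<close>
        moreover have "0 < s1 ''h'' (?q * N + w) \<longleftrightarrow> entry N s ?q w"
          using e[OF w(1) qN(2)] ent by (simp add: entry_def)
        ultimately show "holds next_entry s1 \<longleftrightarrow> w = ?q \<or> A u w \<and> A ?q w \<and> \<not> entry N s ?q w"
          using w qN uu u enc by (simp add: next_entry_def encodes_n encodes_adj u_def)
      qed
      ultimately show ?thesis using ent by simp
    qed
    ultimately show "\<exists>p \<in> K. entry N s p u \<and> marked N s' ''known'' = insert u K \<and>
      (\<forall>i. \<forall>w<N. entry N s' i w \<longleftrightarrow>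
        (if i = u then w = p \<or> A u w \<and> A p w \<and> \<not> entry N s p w else entry N s i w))"
      using q by blast
  }
qed

end

section \<open>Propagation along a fixed root\<close>

context girth6_root
begin

definition agrees :: "memory \<Rightarrow> bool" where
  "agrees s \<longleftrightarrow> (\<forall>u \<in> marked N s ''known''. \<forall>w<N. entry N s u w \<longleftrightarrow> h u w)"

definition saturated :: "memory \<Rightarrow> bool" where
  "saturated s \<longleftrightarrow>
     (\<forall>u \<in> marked N s ''known''. \<forall>w<N. h u w \<longrightarrow> w \<in> marked N s ''known'')"

text \<open>A new row is computed from a correct one by \<open>neighbours_step\<close>. Since a
  newly marked vertex has a marked \<open>h\<close>-neighbour, a saturated memory never gains
  one.\<close>

lemma visit_agrees:
  fixes s :: memory
  assumes s: "encodes s" and u: "s ''u'' 0 < N" and ag: "agrees s"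
  defines "s' \<equiv> sem N visit s"
  shows "agrees s'" and "marked N s ''known'' \<subseteq> marked N s' ''known''"
    and "saturated s \<Longrightarrow> saturated s'"
    and "\<exists>p \<in> marked N s ''known''. h p (s ''u'' 0) \<Longrightarrow> s ''u'' 0 \<in> marked N s' ''known''"
proof -
  let ?K = "marked N s ''known''" and ?K' = "marked N s' ''known''" and ?u = "s ''u'' 0"
  have eh: "entry N s p w \<longleftrightarrow> h p w" if "p \<in> ?K" "w < N" for p w
    using ag that by (auto simp: agrees_def)
  have "agrees s' \<and> ?K \<subseteq> ?K' \<and> (saturated s \<longrightarrow> saturated s') \<and> ((\<exists>p \<in> ?K. h p ?u) \<longrightarrow> ?u \<in> ?K')"
  proof (cases "?u \<in> ?K \<or> \<not> (\<exists>p \<in> ?K. entry N s p ?u)")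
    case True
    from sem_visit(1)[OF s u True] have same: "?K' = ?K" "\<forall>i. \<forall>w<N. entry N s' i w = entry N s i w"
      unfolding s'_def by auto
    then have "agrees s'" "saturated s \<longrightarrow> saturated s'"
      using eh by (auto simp: agrees_def saturated_def)
    moreover have "(\<exists>p \<in> ?K. h p ?u) \<longrightarrow> ?u \<in> ?K'" using True eh u same by auto
    ultimately show ?thesis using same by simp
  next
    case False
    then obtain p where p: "p \<in> ?K" "entry N s p ?u" "?K' = insert ?u ?K"
      "\<forall>i. \<forall>w<N. entry N s' i w \<longleftrightarrow>
        (if i = ?u then w = p \<or> A ?u w \<and> A p w \<and> \<not> entry N s p w else entry N s i w)"
      using sem_visit(2)[OF s u] unfolding s'_def by blast
    have pN: "p < N" using p(1) by (simp add: marked_def)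
    have pu: "h p ?u" using eh p u by blast
    have "entry N s' i w \<longleftrightarrow> h i w" if "i \<in> ?K'" "w < N" for i w
      using that p False eh neighbours_step[OF pN u that(2) pu] by auto
    moreover have "\<not> saturated s" using False p(1) pu u by (auto simp: saturated_def)
    ultimately show ?thesis using p(3) by (auto simp: agrees_def)
  qed
  then show "agrees s'" "?K \<subseteq> ?K'" "saturated s \<Longrightarrow> saturated s'"
    "\<exists>p \<in> ?K. h p ?u \<Longrightarrow> ?u \<in> ?K'" by auto
qed

lemma agrees_cong:
  assumes "s ''known'' = s' ''known''" "s ''h'' = s' ''h''"
  shows "agrees s \<longleftrightarrow> agrees s'" "saturated s \<longleftrightarrow> saturated s'"
proof -
  have "entry N s = entry N s'" using assms(2) by (rule entry_cong)
  moreover have "marked N s ''known'' = marked N s' ''known''" using assms(1) by (rule marked_cong)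
  ultimately show "agrees s \<longleftrightarrow> agrees s'" "saturated s \<longleftrightarrow> saturated s'"
    by (simp_all add: agrees_def saturated_def)
qed

text \<open>Marked sets only grow, so a parent marked at the start of the round is still marked when
  the turn of \<open>u\<close> comes.\<close>

lemma round_agrees:
  fixes s :: memory
  assumes s: "encodes s" and ag: "agrees s"
  defines "s' \<equiv> sem N (LFor ''u'' visit) s"
  shows "agrees s'" and "marked N s ''known'' \<subseteq> marked N s' ''known''"
    and "saturated s \<Longrightarrow> saturated s'"
    and "\<lbrakk>p \<in> marked N s ''known''; u < N; h p u\<rbrakk> \<Longrightarrow> u \<in> marked N s' ''known''"
proof -
  let ?K = "marked N s ''known''"
  let ?I = "\<lambda>k s'. agrees s' \<and> ?K \<subseteq> marked N s' ''known'' \<and> (saturated s \<longrightarrow> saturated s') \<and>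
    (\<forall>u<k. (\<exists>p \<in> ?K. h p u) \<longrightarrow> u \<in> marked N s' ''known'')"
  have "?I N s'"
    unfolding s'_def
  proof (rule sem_For_induct[where P = ?I])
    fix k s1
    assume k: "k < N" and I: "?I k s1" and cnt: "s1 ''u'' 0 = k"
      and fr: "\<And>z. z \<noteq> ''u'' \<Longrightarrow> z \<notin> writes visit \<Longrightarrow> s1 z = s z"
    have enc: "encodes s1"
      using s by (rule encodes_cong; intro fr) (simp_all add: visit_def find_parent_def set_row_def)
    note v = visit_agrees[OF enc, unfolded cnt, OF k]
    show "?I (Suc k) (sem N visit s1)"
      using I v by (fastforce simp: less_Suc_eq)
  next
    fix k s1 v assume "?I k s1"
    moreover have "agrees (upd s1 ''u'' 0 v) = agrees s1" "saturated (upd s1 ''u'' 0 v) = saturated s1"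
      by (rule agrees_cong; simp add: upd_apply)+
    moreover have "marked N (upd s1 ''u'' 0 v) ''known'' = marked N s1 ''known''"
      by (rule marked_cong) (simp add: upd_apply)
    ultimately show "?I k (upd s1 ''u'' 0 v)" by simp
  qed (use ag in auto)
  then show "agrees s'" "?K \<subseteq> marked N s' ''known''" "saturated s \<Longrightarrow> saturated s'"
    "\<lbrakk>p \<in> ?K; u < N; h p u\<rbrakk> \<Longrightarrow> u \<in> marked N s' ''known''" by blast+
qed

text \<open>Every round before saturation marks a new vertex, so \<open>N\<close> rounds suffice.\<close>

lemma sem_propagate:
  fixes s :: memory
  assumes s: "encodes s" and ag: "agrees s" and x: "x \<in> marked N s ''known''"
  defines "s' \<equiv> sem N propagate s"
  shows "agrees s'" and "saturated s'" and "x \<in> marked N s' ''known''"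
proof -
  let ?c = "LFor ''u'' visit"
  \<comment> \<open>With \<open>x\<close> marked from the outset the inequality is strict, so at
    \<open>k = N\<close> it is impossible and saturation remains.\<close>
  let ?I = "\<lambda>k s'. agrees s' \<and> x \<in> marked N s' ''known'' \<and>
    (saturated s' \<or> k < card (marked N s' ''known''))"
  have fin: "finite (marked N s' ''known'')" for s'
    by (simp add: marked_def)
  have "?I N s'"
    unfolding s'_def propagate_def
  proof (rule sem_For_induct[where P = ?I])
    show "?I 0 s" using ag x fin by (auto simp: card_gt_0_iff)
  next
    fix k s1
    assume k: "k < N" and I: "?I k s1"
      and fr: "\<And>z. z \<noteq> ''r'' \<Longrightarrow> z \<notin> writes ?c \<Longrightarrow> s1 z = s z"
    have enc: "encodes s1"
      using s by (rule encodes_cong; intro fr) (simp_all add: visit_def find_parent_def set_row_def)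
    let ?K = "marked N s1 ''known''" and ?K' = "marked N (sem N ?c s1) ''known''"
    have "agrees s1" using I by simp
    note r = round_agrees[OF enc this]
    have "saturated (sem N ?c s1) \<or> Suc k < card ?K'"
    proof (cases "saturated s1")
      case False
      then obtain p u where "p \<in> ?K" "u < N" "h p u" "u \<notin> ?K" by (auto simp: saturated_def)
      then have "?K \<subset> ?K'" using r by blast
      then have "card ?K < card ?K'" using fin by (intro psubset_card_mono)
      then show ?thesis using I False by linarith
    qed (use r in blast)
    then show "?I (Suc k) (sem N ?c s1)" using r I by blast
  next
    fix k s1 v assume "?I k s1"
    moreover have "agrees (upd s1 ''r'' 0 v) = agrees s1" "saturated (upd s1 ''r'' 0 v) = saturated s1"
      by (rule agrees_cong; simp add: upd_apply)+
    moreover have "marked N (upd s1 ''r'' 0 v) ''known'' = marked N s1 ''known''"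
      by (rule marked_cong) (simp add: upd_apply)
    ultimately show "?I k (upd s1 ''r'' 0 v)" by simp
  qed
  moreover have "card (marked N s' ''known'') \<le> N"
    using card_mono[OF finite_lessThan marked_subset] by (metis card_lessThan)
  ultimately show "agrees s'" "saturated s'" "x \<in> marked N s' ''known''" by auto
qed

end

section \<open>The check of a candidate root\<close>

context adjacency
begin

text \<open>The flag \<open>c\<close> starts as the entry for \<open>u v\<close>. A midpoint found
  while it is set is either a second midpoint or one beside an edge, so a single flag tests both the
  third and the fourth clause of \<open>local_root\<close>.\<close>

lemma sem_check_pair:
  fixes s :: memory
  assumes s: "encodes s" and u: "s ''u'' 0 < N" and v: "s ''v'' 0 < N"
  shows "0 < sem N check_pair s ''ok'' 0 \<longleftrightarrow> 0 < s ''ok'' 0 \<and>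
    local_root N A (marked N s ''known'') (entry N s) (s ''u'' 0) (s ''v'' 0)"
proof -
  let ?u = "s ''u'' 0" and ?v = "s ''v'' 0" and ?h = "entry N s" and ?K = "marked N s ''known''"
  let ?s = "sem N (assign ''c'' (cell ''h'' (Var ''u'') (Var ''v''))) s"
  let ?t = "sem N (LFor ''w'' check_triple) ?s"
  define cm where "cm = common N ?h ?u ?v"
  define far where "far w \<longleftrightarrow> ?h ?u ?v \<and> A ?u w \<and> A ?v w \<and> \<not> ?h ?u w \<and> \<not> ?h ?v w" for w
  let ?I = "\<lambda>k s'. (0 < s' ''c'' 0 \<longleftrightarrow> ?h ?u ?v \<or> (\<exists>w<k. cm w)) \<and>
    (0 < s' ''ok'' 0 \<longleftrightarrow> 0 < s ''ok'' 0 \<and>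
      (\<forall>w<k. (cm w \<longrightarrow> \<not> ?h ?u ?v \<and> (\<forall>w'<w. \<not> cm w')) \<and> \<not> far w))"
  have I: "?I N ?t"
  proof (rule sem_For_induct[where P = ?I])
    show "?I 0 ?s" using s by (simp add: upd_apply entry_def encodes_n)
  next
    fix k s'
    assume k: "k < N" and I: "?I k s'" and cnt: "s' ''w'' 0 = k"
      and fr: "\<And>z. z \<noteq> ''w'' \<Longrightarrow> z \<notin> writes check_triple \<Longrightarrow> s' z = ?s z"
    let ?b = "And (Neg (Equal (Var ''u'') (Var ''v'')))
      (And (cell ''h'' (Var ''u'') (Var ''w'')) (cell ''h'' (Var ''w'') (Var ''v'')))"
    let ?f = "And (And (cell ''h'' (Var ''u'') (Var ''v''))
        (And (cell ''adj'' (Var ''u'') (Var ''w'')) (cell ''adj'' (Var ''v'') (Var ''w''))))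
      (And (Neg (cell ''h'' (Var ''u'') (Var ''w''))) (Neg (cell ''h'' (Var ''v'') (Var ''w''))))"
    have eqs: "s' ''h'' = s ''h''" "s' ''adj'' = s ''adj''" "s' ''u'' = s ''u''" "s' ''v'' = s ''v''"
      "s' ''n'' = s ''n''" using fr by (auto simp: upd_apply check_triple_def)
    have b: "holds ?b s' \<longleftrightarrow> cm k"
      using eqs cnt k s by (simp add: cm_def common_def entry_def encodes_n)
    have f: "holds ?f s2 \<longleftrightarrow> far k" if "\<And>z. z \<noteq> ''c'' \<Longrightarrow> z \<noteq> ''ok'' \<Longrightarrow> s2 z = s' z" for s2
      using eqs cnt k s u v that by (simp add: far_def entry_def encodes_n encodes_adj)
    let ?s2 = "sem N (LCond ?b (LCond (Var ''c'') (assign ''ok'' (Const 0)) LSkip ;;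
      assign ''c'' (Const 1)) LSkip) s'"
    have "?s2 z = s' z" if "z \<noteq> ''c''" "z \<noteq> ''ok''" for z
      using that by (intro sem_frame) simp
    then have f: "holds ?f ?s2 \<longleftrightarrow> far k" by (rule f)
    define s2 where "s2 = ?s2"
    have c: "0 < s2 ''c'' 0 \<longleftrightarrow> 0 < s' ''c'' 0 \<or> cm k"
      "0 < s2 ''ok'' 0 \<longleftrightarrow> 0 < s' ''ok'' 0 \<and> \<not> (cm k \<and> 0 < s' ''c'' 0)"
      unfolding s2_def sem_LCond b by (auto simp: sem_LCond upd_apply simp del: sem.simps(4))
    have "sem N check_triple s' = sem N (LCond ?f (assign ''ok'' (Const 0)) LSkip) s2"
      by (simp only: check_triple_def sem.simps(3) s2_def)
    also have "\<dots> = (if far k then upd s2 ''ok'' 0 0 else s2)"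
      unfolding sem_LCond f[folded s2_def] by simp
    finally have eq: "sem N check_triple s' = (if far k then upd s2 ''ok'' 0 0 else s2)" .
    have "sem N check_triple s' ''c'' 0 = s2 ''c'' 0"
      "0 < sem N check_triple s' ''ok'' 0 \<longleftrightarrow> 0 < s2 ''ok'' 0 \<and> \<not> far k"
      unfolding eq by (simp_all add: upd_apply)
    then show "?I (Suc k) (sem N check_triple s')"
      using I c unfolding All_less_Suc Ex_less_Suc by simp blast
  qed (simp_all add: upd_apply)
  have frt: "?t z = s z" if "z \<notin> {''c'', ''w'', ''ok''}" for z
  proof -
    have "?t z = ?s z" using that by (intro sem_frame) (simp add: check_triple_def)
    then show ?thesis using that by (simp add: upd_apply)
  qed
  let ?g = "And (Iff (Var ''c'') (cell ''adj'' (Var ''u'') (Var ''v'')))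
    (Iff (cell ''h'' (Var ''u'') (Var ''v''))
      (And (Elem ''known'' (Var ''v'')) (cell ''h'' (Var ''v'') (Var ''u''))))"
  have "?t ''h'' = s ''h''" "?t ''adj'' = s ''adj''" "?t ''u'' = s ''u''" "?t ''v'' = s ''v''"
    "?t ''n'' = s ''n''" "?t ''known'' = s ''known''" by (rule frt; simp)+
  then have g: "holds ?g ?t \<longleftrightarrow>
      (0 < ?t ''c'' 0 \<longleftrightarrow> A ?u ?v) \<and> (?h ?u ?v \<longleftrightarrow> ?v \<in> ?K \<and> ?h ?v ?u)"
    using s u v by (simp add: entry_def encodes_n encodes_adj marked_def del: sem.simps)
  have "0 < sem N check_pair s ''ok'' 0 \<longleftrightarrow> 0 < ?t ''ok'' 0 \<and> holds ?g ?t"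
    unfolding check_pair_def sem.simps(3) sem_LCond[of N ?g]
    by (auto simp: upd_apply simp del: sem.simps(5) holds_simps)
  also have "\<dots> \<longleftrightarrow> 0 < s ''ok'' 0 \<and> local_root N A ?K ?h ?u ?v"
  proof -
    have cN: "cm w \<Longrightarrow> w < N" for w by (simp add: cm_def common_def)
    \<comment> \<open>In a linear order, no midpoint having a smaller one means that there is at
      most one.\<close>
    have "(\<forall>w<N. cm w \<longrightarrow> (\<forall>w'<w. \<not> cm w')) \<longleftrightarrow> (\<forall>w w'. cm w \<longrightarrow> cm w' \<longrightarrow> w = w')"
      using cN by (metis linorder_neqE_nat nat_neq_iff)
    moreover have "(\<forall>w<N. (cm w \<longrightarrow> \<not> ?h ?u ?v \<and> (\<forall>w'<w. \<not> cm w')) \<and> \<not> far w) \<longleftrightarrow>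
        (\<forall>w<N. cm w \<longrightarrow> (\<forall>w'<w. \<not> cm w')) \<and> (\<forall>w. cm w \<longrightarrow> \<not> ?h ?u ?v) \<and> (\<forall>w<N. \<not> far w)"
      using cN by blast
    moreover have "(\<exists>w<N. cm w) \<longleftrightarrow> (\<exists>w. cm w)" using cN by blast
    moreover have "(\<forall>w<N. \<not> far w) \<longleftrightarrow>
        (\<forall>w<N. ?h ?u ?v \<longrightarrow> A ?u w \<longrightarrow> A ?v w \<longrightarrow> ?h ?u w \<or> ?h ?v w)"
      unfolding far_def by blast
    ultimately have "0 < ?t ''c'' 0 \<longleftrightarrow> ?h ?u ?v \<or> (\<exists>w. cm w)"
      "0 < ?t ''ok'' 0 \<longleftrightarrow> 0 < s ''ok'' 0 \<and> (\<forall>w w'. cm w \<longrightarrow> cm w' \<longrightarrow> w = w') \<and>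
        (\<forall>w. cm w \<longrightarrow> \<not> ?h ?u ?v) \<and>
        (\<forall>w<N. ?h ?u ?v \<longrightarrow> A ?u w \<longrightarrow> A ?v w \<longrightarrow> ?h ?u w \<or> ?h ?v w)"
      using I by simp_all
    then show ?thesis unfolding g local_root_def cm_def[symmetric] by argo
  qed
  finally show ?thesis .
qed

lemma sem_check:
  fixes s :: memory
  assumes s: "encodes s"
  shows "0 < sem N check s ''ok'' 0 \<longleftrightarrow> root_on N A (marked N s ''known'') (entry N s)"
proof -
  let ?h = "entry N s" and ?K = "marked N s ''known''"
  let ?c = "LCond (Elem ''known'' (Var ''u'')) (LFor ''v'' check_pair) LSkip"
  let ?s = "upd s ''ok'' 0 1"
  let ?I = "\<lambda>k s'. 0 < s' ''ok'' 0 \<longleftrightarrow> (\<forall>u<k. u \<in> ?K \<longrightarrow> (\<forall>v<N. local_root N A ?K ?h u v))"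
  have "?I N (sem N (LFor ''u'' ?c) ?s)"
  proof (rule sem_For_induct[where P = ?I])
    show "?I 0 ?s" by (simp add: upd_apply)
  next
    fix k s'
    assume k: "k < N" and I: "?I k s'" and cnt: "s' ''u'' 0 = k"
      and fr: "\<And>z. z \<noteq> ''u'' \<Longrightarrow> z \<notin> writes ?c \<Longrightarrow> s' z = ?s z"
    have fr': "s' z = s z" if "z \<notin> {''u'', ''v'', ''w'', ''c'', ''ok''}" for z
      using fr[of z] that by (simp add: check_pair_def check_triple_def upd_apply)
    let ?J = "\<lambda>j t. 0 < t ''ok'' 0 \<longleftrightarrow> 0 < s' ''ok'' 0 \<and> (\<forall>v<j. local_root N A ?K ?h k v)"
    have "?J N (sem N (LFor ''v'' check_pair) s')"
    proof (rule sem_For_induct[where P = ?J])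
      fix j t
      assume j: "j < N" and J: "?J j t" and cnt': "t ''v'' 0 = j"
        and frt: "\<And>z. z \<noteq> ''v'' \<Longrightarrow> z \<notin> writes check_pair \<Longrightarrow> t z = s' z"
      have frt': "t z = s' z" if "z \<notin> {''v'', ''w'', ''c'', ''ok''}" for z
        using frt[of z] that by (simp add: check_pair_def check_triple_def)
      have u: "t ''u'' 0 = k" using frt' cnt by simp
      have "encodes t" using s by (rule encodes_cong) (simp_all add: frt' fr')
      moreover have "marked N t ''known'' = ?K" by (rule marked_cong) (simp add: frt' fr')
      moreover have "entry N t = ?h" by (rule entry_cong) (simp add: frt' fr')
      ultimately have "0 < sem N check_pair t ''ok'' 0 \<longleftrightarrow>
          0 < t ''ok'' 0 \<and> local_root N A ?K ?h k j"
        using sem_check_pair[of t] u cnt' k j by simp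
      then show "?J (Suc j) (sem N check_pair t)" using J by (auto simp: less_Suc_eq)
    qed (simp_all add: upd_apply)
    moreover have "holds (Elem ''known'' (Var ''u'')) s' \<longleftrightarrow> k \<in> ?K"
      using fr' cnt k by (simp add: marked_def)
    ultimately show "?I (Suc k) (sem N ?c s')"
      using I unfolding sem_LCond by (auto simp: less_Suc_eq simp del: sem.simps(5))
  qed (simp_all add: upd_apply)
  then have "0 < sem N check s ''ok'' 0 \<longleftrightarrow>
      (\<forall>u<N. u \<in> ?K \<longrightarrow> (\<forall>v<N. local_root N A ?K ?h u v))"
    by (simp add: check_def del: sem.simps(4,5))
  then show ?thesis unfolding root_on_def using marked_subset by blast
qed

lemma sem_mark:
  fixes s :: memory
  shows "marked N (sem N mark s) ''done'' =
    marked N s ''done'' \<union> (if 0 < s ''ok'' 0 then marked N s ''known'' else {})"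
proof -
  let ?c = "LCond (And (Var ''ok'') (Elem ''known'' (Var ''u'')))
    (LAssign ''done'' (Var ''u'') (Const 1)) LSkip"
  let ?I = "\<lambda>k s'. \<forall>v. 0 < s' ''done'' v \<longleftrightarrow>
    0 < s ''done'' v \<or> v < k \<and> 0 < s ''ok'' 0 \<and> 0 < s ''known'' v"
  have "?I N (sem N (LFor ''u'' ?c) s)"
  proof (rule sem_For_induct[where P = ?I])
    fix k s'
    assume I: "?I k s'" and cnt: "s' ''u'' 0 = k"
      and fr: "\<And>z. z \<noteq> ''u'' \<Longrightarrow> z \<notin> writes ?c \<Longrightarrow> s' z = s z"
    have "s' ''ok'' = s ''ok''" "s' ''known'' = s ''known''" using fr by auto
    then show "?I (Suc k) (sem N ?c s')"
      using I cnt unfolding sem_LCond by (auto simp: upd_apply less_Suc_eq)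
  qed (simp_all add: upd_apply)
  then show ?thesis by (auto simp: mark_def marked_def simp del: sem.simps)
qed

section \<open>Soundness and completeness of one attempt\<close>

lemma attempt_frame:
  assumes "z \<in> {''n'', ''adj'', ''x'', ''y'', ''a''}"
  shows "sem N (attempt b) s z = s z"
  using assms by (intro sem_frame) (auto simp: prog_defs)

text \<open>Soundness rests on the check alone, whatever the start and the propagation have
  produced. A failed check is the case \<open>K = {}\<close>.\<close>

lemma sem_attempt_done:
  fixes s :: memory
  assumes s: "encodes s"
  shows "\<exists>K g. marked N (sem N (attempt b) s) ''done'' = marked N s ''done'' \<union> K \<and>
    K \<subseteq> {..<N} \<and> root_on N A K g"
proof -
  let ?t = "sem N propagate (sem N (start b) s)"
  let ?r = "sem N check ?t"
  have sem: "sem N (attempt b) s = sem N mark ?r" by (simp add: attempt_def del: sem.simps(4,5))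
  have frt: "?t z = s z" if "z \<in> {''n'', ''adj'', ''done''}" for z
  proof -
    have "?t z = sem N (start b) s z"
      using that by (intro sem_frame) (auto simp: prog_defs)
    also have "\<dots> = s z" using that by (intro sem_frame) (auto simp: prog_defs)
    finally show ?thesis .
  qed
  have "encodes ?t" using s by (rule encodes_cong) (simp_all add: frt)
  note ok = sem_check[OF this]
  have frr: "?r z = ?t z" if "z \<in> {''known'', ''done''}" for z
    using that by (intro sem_frame) (auto simp: prog_defs)
  have K: "marked N ?r ''known'' = marked N ?t ''known''" by (rule marked_cong) (simp add: frr)
  have D: "marked N ?r ''done'' = marked N s ''done''" by (rule marked_cong) (simp add: frr frt)
  show ?thesis
  proof (cases "root_on N A (marked N ?t ''known'') (entry N ?t)")
    case True
    then show ?thesis unfolding sem sem_mark ok D K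
      by (intro exI[of _ "marked N ?t ''known''"] exI[of _ "entry N ?t"]) (simp add: marked_subset)
  next
    case False
    moreover have "root_on N A {} g" for g by (simp add: root_on_def)
    ultimately show ?thesis unfolding sem sem_mark ok D K
      by (intro exI[of _ "{}"]) simp
  qed
qed

text \<open>From one correct row propagation reaches a saturated set of correct rows. By
  \<open>root_on_rows\<close> it passes the check, and \<open>x\<close> is among the vertices marked
  as done.\<close>

lemma (in girth6_root) sem_attempt_complete:
  fixes s :: memory
  assumes s: "encodes s" and lt: "s ''x'' 0 < N" "s ''y'' 0 < N" "s ''a'' 0 < N"
    and b: "\<And>s. holds b s \<longleftrightarrow> \<beta>"
    and row: "\<And>w. w < N \<Longrightarrow> start_row \<beta> (s ''x'' 0) (s ''y'' 0) (s ''a'' 0) w \<longleftrightarrow> h (s ''x'' 0) w"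
  shows "s ''x'' 0 \<in> marked N (sem N (attempt b) s) ''done''"
proof -
  let ?x = "s ''x'' 0"
  let ?s = "sem N (start b) s"
  let ?t = "sem N propagate ?s"
  let ?r = "sem N check ?t"
  have sem: "sem N (attempt b) s = sem N mark ?r" by (simp add: attempt_def del: sem.simps(4,5))
  have frs: "?s z = s z" if "z \<in> {''n'', ''adj''}" for z
    using that by (intro sem_frame) (auto simp: prog_defs)
  have frt: "?t z = ?s z" if "z \<in> {''n'', ''adj''}" for z
    using that by (intro sem_frame) (auto simp: prog_defs)
  have es: "encodes ?s" using s by (rule encodes_cong) (simp_all add: frs)
  then have et: "encodes ?t" by (rule encodes_cong) (simp_all add: frt)
  have x: "marked N ?s ''known'' = {?x}" using sem_start(1)[OF s lt b] .
  have "agrees ?s" using sem_start(2)[OF s lt b] row unfolding agrees_def x by auto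
  note p = sem_propagate[OF es this, of ?x]
  have "root_on N A (marked N ?t ''known'') (entry N ?t)"
    using p x by (intro root_on_rows marked_subset) (auto simp: agrees_def saturated_def)
  then have "0 < ?r ''ok'' 0" using sem_check[OF et] by simp
  moreover have "marked N ?r ''known'' = marked N ?t ''known''"
    by (intro marked_cong sem_frame) (auto simp: prog_defs)
  ultimately show ?thesis unfolding sem sem_mark using p(3) x by simp
qed

section \<open>The edge tried for each vertex\<close>

definition is_top :: "nat \<Rightarrow> nat \<Rightarrow> bool" where
  "is_top y x \<longleftrightarrow> (if \<exists>w<N. A y w then x < N \<and> A y x \<and> (\<forall>w<N. A y w \<longrightarrow> w \<le> x) else x = y)"

lemma sem_select_edge:
  fixes s :: memory
  assumes s: "encodes s" and y: "s ''y'' 0 < N"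
  defines "s' \<equiv> sem N select_edge s"
  shows "is_top (s ''y'' 0) (s' ''x'' 0)" and "s' ''x'' 0 < N" and "s' ''a'' 0 < N"
    and "\<exists>w<N. A (s' ''x'' 0) w \<and> A (s ''y'' 0) w \<Longrightarrow>
      A (s' ''x'' 0) (s' ''a'' 0) \<and> A (s ''y'' 0) (s' ''a'' 0)"
proof -
  let ?y = "s ''y'' 0"
  let ?c = "LCond (cell ''adj'' (Var ''y'') (Var ''w'')) (assign ''x'' (Var ''w'')) LSkip"
  let ?s = "upd s ''x'' 0 ?y"
  let ?t = "sem N (LFor ''w'' ?c) ?s"
  let ?I = "\<lambda>k s'. s' ''x'' 0 < N \<and>
    (if \<exists>w<k. A ?y w then A ?y (s' ''x'' 0) \<and> (\<forall>w<k. A ?y w \<longrightarrow> w \<le> s' ''x'' 0) else s' ''x'' 0 = ?y)"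
  have I: "?I N ?t"
  proof (rule sem_For_induct[where P = ?I])
    fix k s'
    assume k: "k < N" and I: "?I k s'" and cnt: "s' ''w'' 0 = k"
      and fr: "\<And>z. z \<noteq> ''w'' \<Longrightarrow> z \<notin> writes ?c \<Longrightarrow> s' z = ?s z"
    have "s' ''y'' = s ''y''" "s' ''adj'' = s ''adj''" "s' ''n'' = s ''n''"
      using fr by (auto simp: upd_apply)
    then have b: "holds (cell ''adj'' (Var ''y'') (Var ''w'')) s' \<longleftrightarrow> A ?y k"
      using cnt k s y by (simp add: encodes_n encodes_adj)
    show "?I (Suc k) (sem N ?c s')"
    proof (cases "A ?y k")
      case True
      then have "sem N ?c s' ''x'' 0 = k" unfolding sem_LCond b using cnt by (simp add: upd_apply)
      then show ?thesis using True k by auto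
    next
      case False
      then have "sem N ?c s' = s'" unfolding sem_LCond b by simp
      then show ?thesis using False I by (auto simp: less_Suc_eq split: if_splits)
    qed
  qed (use y in \<open>simp_all add: upd_apply\<close>)
  let ?x = "?t ''x'' 0"
  have frt: "?t z = s z" if "z \<notin> {''w'', ''x''}" for z
  proof -
    have "?t z = ?s z" using that by (intro sem_frame) simp
    then show ?thesis using that by (simp add: upd_apply)
  qed
  let ?d = "LCond (And (cell ''adj'' (Var ''x'') (Var ''w'')) (cell ''adj'' (Var ''y'') (Var ''w'')))
    (assign ''a'' (Var ''w'')) LSkip"
  let ?r = "upd ?t ''a'' 0 ?x"
  let ?J = "\<lambda>k s'. s' ''a'' 0 < N \<and>
    ((\<exists>w<k. A ?x w \<and> A ?y w) \<longrightarrow> A ?x (s' ''a'' 0) \<and> A ?y (s' ''a'' 0))"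
  have J: "?J N (sem N (LFor ''w'' ?d) ?r)"
  proof (rule sem_For_induct[where P = ?J])
    show "?J 0 ?r" using I by (simp add: upd_apply del: sem.simps)
  next
    fix k s'
    assume k: "k < N" and J: "?J k s'" and cnt: "s' ''w'' 0 = k"
      and fr: "\<And>z. z \<noteq> ''w'' \<Longrightarrow> z \<notin> writes ?d \<Longrightarrow> s' z = ?r z"
    have "s' ''y'' = s ''y''" "s' ''adj'' = s ''adj''" "s' ''n'' = s ''n''" "s' ''x'' 0 = ?x"
      using fr frt by (simp_all add: upd_apply del: sem.simps(4,5))
    then have b: "holds (And (cell ''adj'' (Var ''x'') (Var ''w'')) (cell ''adj'' (Var ''y'') (Var ''w''))) s' \<longleftrightarrow>
        A ?x k \<and> A ?y k"
      using cnt k s y I by (simp add: encodes_n encodes_adj del: sem.simps)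
    show "?J (Suc k) (sem N ?d s')"
    proof (cases "A ?x k \<and> A ?y k")
      case True
      then have "sem N ?d s' ''a'' 0 = k" unfolding sem_LCond[of N "And _ _"] b
        using cnt by (simp add: upd_apply)
      then show ?thesis using True k by simp
    next
      case False
      then have "sem N ?d s' = s'" unfolding sem_LCond[of N "And _ _"] b
        by (simp only: if_False sem.simps)
      then show ?thesis using False J by (auto simp: less_Suc_eq)
    qed
  qed (simp_all add: upd_apply)
  have s': "s' = sem N (LFor ''w'' ?d) ?r"
    by (simp add: s'_def select_edge_def del: sem.simps(4,5))
  have "s' ''x'' = ?r ''x''" unfolding s' by (rule sem_frame) simp
  then have x: "s' ''x'' 0 = ?x" by (simp add: upd_apply del: sem.simps)
  show "is_top ?y (s' ''x'' 0)" "s' ''x'' 0 < N"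
    using I unfolding x is_top_def by (auto split: if_splits)
  show "s' ''a'' 0 < N" "\<exists>w<N. A (s' ''x'' 0) w \<and> A ?y w \<Longrightarrow>
      A (s' ''x'' 0) (s' ''a'' 0) \<and> A ?y (s' ''a'' 0)"
    using J unfolding x s'[symmetric] by blast+
qed

text \<open>The new vertices may already be done with another root; \<open>root_on_Un\<close>
  reconciles the two.\<close>

lemma attempt_extends:
  fixes s :: memory
  assumes s: "encodes s" and D: "root_on N A (marked N s ''done'') f"
  shows "\<exists>g. root_on N A (marked N (sem N (attempt b) s) ''done'') g"
proof -
  from sem_attempt_done[OF s, of b] obtain K g where
    K: "marked N (sem N (attempt b) s) ''done'' = marked N s ''done'' \<union> K" "K \<subseteq> {..<N}"
      "root_on N A K g" by blast
  then show ?thesis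
    using root_on_Un[OF D _ K(3)] root_on_closed[OF D marked_subset] root_on_closed[OF K(3,2)] by auto
qed

lemma sem_try_vertex:
  fixes s :: memory
  assumes s: "encodes s" and D: "root_on N A (marked N s ''done'') f"
  shows "\<exists>g. root_on N A (marked N (sem N try_vertex s) ''done'') g"
    and "marked N s ''done'' \<subseteq> marked N (sem N try_vertex s) ''done''"
proof -
  let ?s = "sem N select_edge s"
  let ?t = "sem N (attempt (Const 0)) ?s"
  have sem: "sem N try_vertex s = sem N (attempt (Const 1)) ?t"
    by (simp add: try_vertex_def)
  have es: "encodes ?s"
    using s by (rule encodes_cong) (rule sem_frame; simp add: select_edge_def)+
  then have et: "encodes ?t" by (rule encodes_cong) (simp_all add: attempt_frame)
  have ds: "marked N ?s ''done'' = marked N s ''done''"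
    by (intro marked_cong sem_frame) (simp add: select_edge_def)
  obtain g where "root_on N A (marked N ?t ''done'') g"
    using attempt_extends[OF es] D ds by metis
  then show "\<exists>g. root_on N A (marked N (sem N try_vertex s) ''done'') g"
    unfolding sem by (rule attempt_extends[OF et])
  show "marked N s ''done'' \<subseteq> marked N (sem N try_vertex s) ''done''"
    unfolding sem using sem_attempt_done[OF es, of "Const 0"] sem_attempt_done[OF et, of "Const 1"] ds
    by auto
qed

text \<open>One of the two attempts starts from the true row of \<open>x\<close>: which one depends
  on whether \<open>a\<close> is an \<open>h\<close>-neighbour of \<open>x\<close> or of
  \<open>y\<close>.\<close>

lemma (in girth6_root) sem_try_vertex_complete:
  fixes s :: memory
  assumes s: "encodes s" and y: "s ''y'' 0 < N" and x: "is_top (s ''y'' 0) x"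
    and edge: "h x (s ''y'' 0) \<or> \<not> (\<exists>w<N. A (s ''y'' 0) w)"
  shows "x \<in> marked N (sem N try_vertex s) ''done''"
proof -
  let ?y = "s ''y'' 0"
  let ?s = "sem N select_edge s"
  let ?t = "sem N (attempt (Const 0)) ?s"
  have sem: "sem N try_vertex s = sem N (attempt (Const 1)) ?t"
    by (simp add: try_vertex_def)
  have es: "encodes ?s"
    using s by (rule encodes_cong) (rule sem_frame; simp add: select_edge_def)+
  then have et: "encodes ?t" by (rule encodes_cong) (simp_all add: attempt_frame)
  note sel = sem_select_edge[OF s y]
  have "?s ''y'' = s ''y''" by (rule sem_frame) (simp add: select_edge_def)
  then have ys: "?s ''y'' 0 = ?y" by simp
  have xs: "?s ''x'' 0 = x"
    using sel(1) x unfolding is_top_def by (auto split: if_splits intro: le_antisym)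
  let ?a = "?s ''a'' 0"
  have xN: "x < N" using sel(2) xs by simp
  have "(\<forall>w<N. start_row False x ?y ?a w \<longleftrightarrow> h x w) \<or> (\<forall>w<N. start_row True x ?y ?a w \<longleftrightarrow> h x w)"
  proof (cases "\<exists>w<N. A ?y w")
    case False
    \<comment> \<open>For an isolated vertex both the start row and the row of \<open>h\<close> are
      empty.\<close>
    then have "x = ?y" using x by (simp add: is_top_def)
    then show ?thesis using False edge_adjacent y by (auto simp: start_row_def)
  next
    case True
    then have xy: "h x ?y" using edge by simp
    then have Axy: "A x ?y" using edge_adjacent xN y by blast
    show ?thesis
    proof (cases "\<exists>w<N. A x w \<and> A ?y w")
      case True
      then have a: "?a < N" "A x ?a" "A ?y ?a" using sel(3,4) xs by auto
      from no_far_common[OF xN y a(1) xy a(2,3)] consider "h x ?a" | "h ?y ?a" by blast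
      then show ?thesis
      proof cases
        case 1
        then show ?thesis using neighbours_edge(1)[OF xN y xy a] Axy by (auto simp: start_row_def)
      next
        case 2
        then show ?thesis using neighbours_edge(2)[OF xN y xy a] Axy by (auto simp: start_row_def)
      qed
    next
      case False
      \<comment> \<open>Without common neighbours, \<open>y\<close> is the only
        \<open>h\<close>-neighbour of \<open>x\<close>, and both start rows consist of
        \<open>y\<close> alone.\<close>
      then show ?thesis using common_split[OF xN y xy] Axy xy unfolding start_row_def by blast
    qed
  qed
  then show ?thesis
  proof
    assume row: "\<forall>w<N. start_row False x ?y ?a w \<longleftrightarrow> h x w"
    have "x \<in> marked N ?t ''done''"
      using sem_attempt_complete[OF es, of "Const 0" False] sel(2,3) xs ys y row
      by (simp add: holds_def)
    then show ?thesis unfolding sem using sem_attempt_done[OF et, of "Const 1"] by auto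
  next
    assume row: "\<forall>w<N. start_row True x ?y ?a w \<longleftrightarrow> h x w"
    have "?t ''x'' = ?s ''x''" "?t ''y'' = ?s ''y''" "?t ''a'' = ?s ''a''"
      by (simp_all add: attempt_frame)
    then show ?thesis unfolding sem
      using sem_attempt_complete[OF et, of "Const 1" True] sel(2,3) xs ys y row
      by (simp add: holds_def)
  qed
qed


section \<open>The loop over all vertices and the verdict\<close>

lemma sem_loop:
  fixes s :: memory
  assumes s: "encodes s" and init: "\<And>i. s ''done'' i = 0"
  shows "\<exists>g. root_on N A (marked N (sem N (LFor ''y'' try_vertex) s) ''done'') g"
proof -
  let ?I = "\<lambda>(k::nat) s'. \<exists>g. root_on N A (marked N s' ''done'') g"
  show ?thesis
  proof (rule sem_For_induct[where P = ?I])
    have "marked N s ''done'' = {}" by (simp add: marked_def init)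
    then show "?I 0 s" by (simp add: root_on_def)
  next
    fix k s'
    assume I: "?I k s'" and fr: "\<And>z. z \<noteq> ''y'' \<Longrightarrow> z \<notin> writes try_vertex \<Longrightarrow> s' z = s z"
    have "encodes s'" using s by (rule encodes_cong; intro fr) (simp_all add: prog_defs)
    then show "?I (Suc k) (sem N try_vertex s')" using I sem_try_vertex(1) by blast
  qed (simp add: marked_def upd_apply)
qed

text \<open>Marks in \<open>done\<close> are never withdrawn, so it suffices that the round of
  \<open>y\<close> marks \<open>x\<close>.\<close>

lemma (in girth6_root) sem_loop_complete:
  fixes s :: memory
  assumes s: "encodes s" and y: "y < N" "is_top y x" "h x y \<or> \<not> (\<exists>w<N. A y w)"
    and init: "\<And>i. s ''done'' i = 0"
  shows "x \<in> marked N (sem N (LFor ''y'' try_vertex) s) ''done''"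
proof -
  let ?I = "\<lambda>k s'. (\<exists>g. root_on N A (marked N s' ''done'') g) \<and>
    (y < k \<longrightarrow> x \<in> marked N s' ''done'')"
  have "?I N (sem N (LFor ''y'' try_vertex) s)"
  proof (rule sem_For_induct[where P = ?I])
    have "marked N s ''done'' = {}" by (simp add: marked_def init)
    then show "?I 0 s" by (simp add: root_on_def)
  next
    fix k s'
    assume k: "k < N" and I: "?I k s'" and cnt: "s' ''y'' 0 = k"
      and fr: "\<And>z. z \<noteq> ''y'' \<Longrightarrow> z \<notin> writes try_vertex \<Longrightarrow> s' z = s z"
    have e: "encodes s'" using s by (rule encodes_cong; intro fr) (simp_all add: prog_defs)
    from I obtain f where f: "root_on N A (marked N s' ''done'') f" by blast
    note t = sem_try_vertex[OF e f]
    have "x \<in> marked N (sem N try_vertex s') ''done''" if "y < Suc k"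
    proof (cases "y = k")
      case True
      then show ?thesis using sem_try_vertex_complete[OF e, of x] cnt y by simp
    next
      case False
      then show ?thesis using that I t(2) by auto
    qed
    then show "?I (Suc k) (sem N try_vertex s')" using t(1) by blast
  qed (simp add: marked_def upd_apply)
  then show ?thesis using y by simp
qed

lemma accepting_main:
  "accepting (sem N main s) \<longleftrightarrow> {..<N} \<subseteq> marked N (sem N (LFor ''y'' try_vertex) s) ''done''"
proof -
  let ?c = "LCond (Elem ''done'' (Var ''u'')) LSkip (assign ''out'' (Const 0))"
  let ?t = "sem N (LFor ''y'' try_vertex) s"
  let ?s = "upd ?t ''out'' 0 1"
  let ?I = "\<lambda>k s'. s' ''out'' 0 = (if \<forall>u<k. 0 < ?t ''done'' u then 1 else 0)"
  have "?I N (sem N (LFor ''u'' ?c) ?s)"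
  proof (rule sem_For_induct[where P = ?I])
    show "?I 0 ?s" by (simp add: upd_apply del: sem.simps)
  next
    fix k s'
    assume I: "?I k s'" and cnt: "s' ''u'' 0 = k"
      and fr: "\<And>z. z \<noteq> ''u'' \<Longrightarrow> z \<notin> writes ?c \<Longrightarrow> s' z = ?s z"
    have "s' ''done'' = ?t ''done''" using fr by (simp add: upd_apply del: sem.simps)
    then have b: "holds (Elem ''done'' (Var ''u'')) s' \<longleftrightarrow> 0 < ?t ''done'' k"
      using cnt by (simp del: sem.simps)
    show "?I (Suc k) (sem N ?c s')"
    proof (cases "0 < ?t ''done'' k")
      case True
      then have "sem N ?c s' = s'" unfolding sem_LCond b by simp
      then show ?thesis using True I by (auto simp: less_Suc_eq simp del: sem.simps)
    next
      case False
      then have "sem N ?c s' ''out'' 0 = 0" unfolding sem_LCond b by (simp add: upd_apply)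
      then show ?thesis using False by auto
    qed
  qed (simp add: upd_apply del: sem.simps)
  moreover have "sem N main s = sem N (LFor ''u'' ?c) ?s" by (simp add: main_def del: sem.simps(4,5))
  ultimately show ?thesis by (auto simp: accepting_def marked_def simp del: sem.simps split: if_splits)
qed

text \<open>Let \<open>x\<close> be the largest vertex not done. The done vertices form a closed
  set, so the neighbours of \<open>x\<close> and their neighbours are not done either and do not
  exceed \<open>x\<close>. Hence \<open>x\<close> is the largest neighbour of each of its
  \<open>h\<close>-neighbours, and trying one of these would have marked it.\<close>

lemma (in girth6_root) main_complete:
  assumes s: "encodes s" and init: "\<And>i. s ''done'' i = 0"
  shows "accepting (sem N main s)"
  unfolding accepting_main
proof (rule ccontr)
  let ?D = "marked N (sem N (LFor ''y'' try_vertex) s) ''done''"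
  assume "\<not> {..<N} \<subseteq> ?D"
  then have ne: "{..<N} - ?D \<noteq> {}" by auto
  define x where "x = Max ({..<N} - ?D)"
  have x: "x < N" "x \<notin> ?D" using Max_in[OF _ ne] by (auto simp: x_def)
  have max: "w \<le> x" if "w < N" "w \<notin> ?D" for w
    using that by (auto simp: x_def intro: Max_ge)
  obtain g where "root_on N A ?D g" using sem_loop[OF s init] by blast
  then have "closed ?D" using marked_subset by (rule root_on_closed)
  then have out: "w \<notin> ?D" if "v \<notin> ?D" "v < N" "w < N" "A v w" for v w
    using that sym unfolding closed_def by blast
  show False
  proof (cases "\<exists>w<N. A x w")
    case False
    then show False using sem_loop_complete[OF s x(1) _ _ init, of x] x by (simp add: is_top_def)
  next
    case True
    \<comment> \<open>The first step of a path of length one or two in \<open>h\<close> provides the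
      neighbour.\<close>
    then obtain y where y: "y < N" "h x y" using square x(1) by blast
    then have Ayx: "A y x" using edge_adjacent h_sym x(1) by blast
    have "w \<le> x" if "w < N" "A y w" for w
      using out[of y w] out[of x y] that max y x edge_adjacent by blast
    then have "is_top y x" using Ayx x(1) by (auto simp: is_top_def)
    then show False using sem_loop_complete[OF s y(1) _ _ init] y(2) x by blast
  qed
qed

text \<open>Once every vertex is done, the invariant of the outer loop is a root of the whole
  graph.\<close>

lemma main_sound:
  assumes s: "encodes s" and init: "\<And>i. s ''done'' i = 0" and acc: "accepting (sem N main s)"
  shows "\<exists>g. root_on N A {..<N} g"
proof -
  have "marked N (sem N (LFor ''y'' try_vertex) s) ''done'' = {..<N}"
    using acc marked_subset unfolding accepting_main by blast
  then show ?thesis using sem_loop[OF s init] by simp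
qed

end

text \<open>An isolated vertex makes the minimum degree 0, but no program runs in time 0; hence
  \<open>max 1\<close>.\<close>

theorem theorem3p5:
  "\<exists>(c :: prog) (C :: nat).
     decides_in_time c
       (\<lambda>G. \<exists>H. simple_graph H \<and> 6 \<le> girth H \<and> G = square H)
       (\<lambda>G. C * (max 1 (min_degree G) * card (verts G) ^ 4))"
proof (intro exI)
  let ?P = "\<lambda>G. \<exists>H. simple_graph H \<and> 6 \<le> girth H \<and> G = square H"
  let ?T = "\<lambda>G. const_factor main * (max 1 (min_degree G) * card (verts G) ^ 4)"
  \<comment> \<open>The exponent of the word limit must strictly exceed the cost of every
    expression.\<close>
  let ?k = "Suc (width main)"
  show "decides_in_time (compile main) ?P ?T"
    unfolding decides_in_time_def
  proof (rule exI[of _ ?k], intro allI impI)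
    fix G :: "nat graph" and n
    assume G: "simple_graph G \<and> verts G = {0..<n} \<and> 0 < n"
    let ?A = "\<lambda>u v. {u, v} \<in> edges G"
    have ne: "u \<noteq> v" if "?A u v" for u v
      using that G by (fastforce simp: simple_graph_def)
    interpret adjacency n ?A
      by unfold_locales (use ne ne[of u u for u] in \<open>auto simp: insert_commute\<close>)
    have "input G ''adj'' (u * n + v) = (if ?A u v then 1 else 0)" if "u < n" "v < n" for u v
    proof -
      have "(\<exists>u'\<in>{0..<n}. \<exists>v'\<in>{0..<n}. u * n + v = u' * n + v' \<and> ?A u' v') \<longleftrightarrow> ?A u v"
        using that index_eq_iff[of v n] by auto
      then show ?thesis using G by (simp add: input_def)
    qed
    then have enc: "encodes (input G)" using G by (simp add: encodes_def input_def)
    \<comment> \<open>Matrix entries are at most 1, hence at most \<open>n\<close>, as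
      \<open>n\<close> is positive.\<close>
    have bnd: "bounded n (input G)" using G by (auto simp: bounded_def input_def)
    have blank: "input G ''done'' i = 0" for i by (simp add: input_def)
    from exec_compile[OF wf_main bnd, of ?k] G obtain t where
      t: "t \<le> const_factor main * n ^ 4" "exec ((n + 2) ^ ?k) (compile main) (input G) t (sem n main (input G))"
      unfolding nesting_main by blast
    have "1 * n ^ 4 \<le> max 1 (min_degree G) * n ^ 4" by (intro mult_le_mono1) simp
    then have "const_factor main * n ^ 4 \<le> ?T G" using G by (simp del: max_def)
    with t(1) have "t \<le> ?T G" by linarith
    moreover have "accepting (sem n main (input G)) \<longleftrightarrow> ?P G"
    proof
      assume "accepting (sem n main (input G))"
      then show "?P G" using main_sound[OF enc blank] root_on_imp_square G by blast
    next
      assume "?P G"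
      then obtain H where "simple_graph H" "6 \<le> girth H" "G = square H" by blast
      then interpret girth6_root n ?A "\<lambda>u v. {u, v} \<in> edges H"
        using girth6_root_of_square G by blast
      show "accepting (sem n main (input G))" by (rule main_complete[OF enc blank])
    qed
    ultimately show "\<exists>t s. exec ((n + 2) ^ ?k) (compile main) (input G) t s \<and> t \<le> ?T G \<and>
        (accepting s \<longleftrightarrow> ?P G)"
      using t(2) by blast
  qed
qed

end
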